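(* Let $q\ge0$, $1\le t\le2^q$ and $k\ge3$ be integers, let $\langle k\rangle^\perp:=\{(r,k)\mid1\le r<k\}$, and let $\mathcal O\subseteq\langle k\rangle^\perp$. If $|\mathcal O|=j$ and $1\le j\le k-1$, then $$\Delta(\mathbf m,\mathcal O;k)=U(m_1;k)\quad\text{and}\quad k\,\Delta(\mathbf m,\mathcal O;k)=C(\mathbf m,\mathcal O;k),$$ where $\mathbf m=(2^{q+1}-t,\ t,\ 2^q+t,\ 3\cdot2^q+t,\ \ldots,\ 2^q\cdot[2^{k-2}-1]+t-j)$, i.e. $m_1=2^{q+1}-t$, $m_i=2^q\cdot[2^{i-2}-1]+t$ for $2\le i\le k-1$, and $m_k=2^q\cdot[2^{k-2}-1]+t-j$.
   Context: A mass distribution (or mass) on $\mathbb{R}^d$ is a positive, finite Borel measure $\mu$ such that every hyperplane has $\mu$-measure zero. Given hyperplanes $H_1,\ldots,H_\ell$ in $\mathbb{R}^d$ with closed half-spaces $H_i^0,H_i^1$ bounded by $H_i$, they equipartition $\mu$ if $\mu(H_1^{g_1}\cap\cdots\cap H_\ell^{g_\ell})=\frac{1}{2^\ell}\mu(\mathbb{R}^d)$ for all $(g_1,\ldots,g_\ell)\in\{0,1\}^\ell$. Hyperplanes are orthogonal, $H_r\perp H_s$, if their normal vectors are orthogonal. For $\mathbf m=(m_1,\ldots,m_k)\in\mathbb{N}^k$ ($\mathbb{N}\ni0$) with $m_1\ge1$ and $\mathcal O\subseteq\{(r,s)\mid1\le r<s\le k\}$, $\Delta(\mathbf m,\mathcal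 O;k)$ denotes the minimum dimension $d$ such that for any family of masses $\{\mu_{i,j}\}_{1\le i\le k,\,1\le j\le m_i}$ on $\mathbb{R}^d$ there exist $k$ hyperplanes $H_1,\ldots,H_k$ in $\mathbb{R}^d$ such that $H_r\perp H_s$ for all $(r,s)\in\mathcal O$ and, for each $1\le i\le k$, the hyperplanes $H_i,\ldots,H_k$ equipartition each of $\mu_{i,1},\ldots,\mu_{i,m_i}$. Write $$C(\mathbf m,\mathcal O;k)=\sum_{i=1}^km_i(2^{k-i+1}-1)+|\mathcal O|.$$ For $m\ge1$ written as $m=2^p+r$ with $0\le r<2^p$, $U(m;k):=2^{p+k-1}+r$; equivalently $U(2^{q+1}-t;k)=2^q\cdot[2^{k-1}+1]-t$ for $q\ge0$ and $1\le t\le2^q$. *)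

theory Defs
  imports "HOL-Analysis.Analysis" "HOL-Library.Extended_Nat" "HOL-Library.Discrete_Functions"
begin

text \<open>
  The dimension \<open>d\<close> is minimised over, so it cannot be a type. A point of $d$-dimensional Euclidean
  space is an extensional function on \<open>{..<d}\<close>, and the Borel sets are those of the finite product
  of \<open>d\<close> copies of the real Borel algebra.
\<close>

abbreviation euclid :: "nat \<Rightarrow> (nat \<Rightarrow> real) measure" where
  "euclid d \<equiv> PiM {..<d} (\<lambda>_. borel)"

definition dotp :: "nat \<Rightarrow> (nat \<Rightarrow> real) \<Rightarrow> (nat \<Rightarrow> real) \<Rightarrow> real" where
  "dotp d x y = (\<Sum>i<d. x i * y i)"

text \<open>
  A hyperplane is given by a normal vector, nonzero in its first \<open>d\<close> coordinates, and an offset.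
  There is thus no hyperplane in dimension 0.
\<close>

type_synonym hyperplane = "(nat \<Rightarrow> real) \<times> real"

definition is_hyperplane :: "nat \<Rightarrow> hyperplane \<Rightarrow> bool" where
  "is_hyperplane d H \<longleftrightarrow> (\<exists>i<d. fst H i \<noteq> 0)"

definition hyperplane_points :: "nat \<Rightarrow> hyperplane \<Rightarrow> (nat \<Rightarrow> real) set" where
  "hyperplane_points d H = {x \<in> space (euclid d). dotp d (fst H) x = snd H}"

definition half_space :: "nat \<Rightarrow> hyperplane \<Rightarrow> bool \<Rightarrow> (nat \<Rightarrow> real) set" where
  "half_space d H g =
     {x \<in> space (euclid d). if g then dotp d (fst H) x \<ge> snd H else dotp d (fst H) x \<le> snd H}"

definition orthogonal_hyperplanes :: "nat \<Rightarrow> hyperplane \<Rightarrow> hyperplane \<Rightarrow> bool" where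
  "orthogonal_hyperplanes d H H' \<longleftrightarrow> dotp d (fst H) (fst H') = 0"

text \<open>
  ``Positive'' is read as non-negative, so the zero measure is a mass; it is equipartitioned by
  any hyperplanes, and excluding it would not change \<open>Delta\<close> below.
\<close>

definition mass :: "nat \<Rightarrow> (nat \<Rightarrow> real) measure \<Rightarrow> bool" where
  "mass d \<mu> \<longleftrightarrow> sets \<mu> = sets (euclid d) \<and> finite_measure \<mu> \<and>
     (\<forall>H. is_hyperplane d H \<longrightarrow> emeasure \<mu> (hyperplane_points d H) = 0)"

definition equipartition ::
  "nat \<Rightarrow> nat set \<Rightarrow> (nat \<Rightarrow> hyperplane) \<Rightarrow> (nat \<Rightarrow> real) measure \<Rightarrow> bool" where
  "equipartition d I H \<mu> \<longleftrightarrow>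
     (\<forall>g :: nat \<Rightarrow> bool.
        measure \<mu> (\<Inter>l\<in>I. half_space d (H l) (g l)) = measure \<mu> (space \<mu>) / 2 ^ card I)"

definition admissible_dim :: "(nat \<Rightarrow> nat) \<Rightarrow> (nat \<times> nat) set \<Rightarrow> nat \<Rightarrow> nat \<Rightarrow> bool" where
  "admissible_dim m \<O> k d \<longleftrightarrow>
     (\<forall>\<mu> :: nat \<Rightarrow> nat \<Rightarrow> (nat \<Rightarrow> real) measure.
        (\<forall>i\<in>{1..k}. \<forall>j\<in>{1..m i}. mass d (\<mu> i j)) \<longrightarrow>
        (\<exists>H :: nat \<Rightarrow> hyperplane.
           (\<forall>i\<in>{1..k}. is_hyperplane d (H i)) \<and>
           (\<forall>(r, s)\<in>\<O>. orthogonal_hyperplanes d (H r) (H s)) \<and>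
           (\<forall>i\<in>{1..k}. \<forall>j\<in>{1..m i}. equipartition d {i..k} H (\<mu> i j))))"

text \<open>
  The infimum is a minimum unless no dimension is admissible, in which case it is \<open>\<infinity>\<close>; an equation
  \<open>Delta m \<O> k = enat n\<close> therefore includes the existence of the minimum.
\<close>

definition Delta :: "(nat \<Rightarrow> nat) \<Rightarrow> (nat \<times> nat) set \<Rightarrow> nat \<Rightarrow> enat" where
  "Delta m \<O> k = (INF d\<in>{d. admissible_dim m \<O> k d}. enat d)"

definition C_count :: "(nat \<Rightarrow> nat) \<Rightarrow> (nat \<times> nat) set \<Rightarrow> nat \<Rightarrow> nat" where
  "C_count m \<O> k = (\<Sum>i=1..k. m i * (2 ^ (k - i + 1) - 1)) + card \<O>"

text \<open>With $m = 2^p + r$ and $0 \le r < 2^p$ one has \<open>p = floor_log m\<close>.\<close>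

definition U_bound :: "nat \<Rightarrow> nat \<Rightarrow> nat" where
  "U_bound m k = 2 ^ (floor_log m + k - 1) + (m - 2 ^ floor_log m)"

end

theory Submission
  imports Defs "HOL-Library.Z2" "HOL-Library.Poly_Mapping" "HOL-Library.Function_Algebras"
    "Jordan_Normal_Form.Determinant"
begin

text \<open>
  Lower bound: take disjoint intervals of the moment curve as masses. A hyperplane meets the curve in
  at most \<open>d\<close> points, while an equipartition of one interval by \<open>n\<close> hyperplanes uses at least
  \<open>2 ^ n - 1\<close> points of it. This gives \<open>(\<Sum>i=1..k. m i * (2 ^ (k - i + 1) - 1)) \<le> k * d\<close>, which forces
  \<open>d\<close> to be at least the claimed value because \<open>card \<O> < k\<close>.

  Upper bound: parametrise hyperplanes by the boundary of the cube in dimension \<open>d + 1\<close>, so that the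
  group generated by the \<open>k\<close> sign changes acts on the \<open>k\<close>-fold product of cube boundaries. By
  inclusion-exclusion the conditions become the vanishing of \<open>k * d\<close> real functions, the \<open>c\<close>-th of
  which changes sign under the \<open>i\<close>-th generator iff \<open>i \<in> \<rho> c\<close>. Subdivide the cubes into a grid. The
  signs of the functions at the cells are mod 2 cochains; the cup product of their coboundaries is a
  top cochain whose value on the quotient is the coefficient of \<open>\<Prod>i. X i ^ d\<close> in
  \<open>\<Prod>c. \<Sum>i\<in>\<rho> c. X i\<close>. If it is odd, some small flag of cells sees a sign change of every function, and a
  limit of such flags is a common zero. The coefficient is computed in characteristic two: the
  linear forms attached to one mass multiply to a Dickson product, which is a Moore determinant, and
  the variables are eliminated one after the other.
\<close>

section \<open>Mod 2 cochains on cubical grids\<close>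

text \<open>As simplification rules these turn every sum of bits into a bitwise operation.\<close>

declare add_bit_eq_xor [simp del] mult_bit_eq_and [simp del]

section \<open>Sums of bits and the mod 2 coboundary\<close>

lemma bit_add_self [simp]: "a + a = (0::bit)"
  by (cases a) auto

text \<open>The terms at \<open>x, y\<close> and at \<open>y, x\<close> cancel mod 2. This is the
  form in which the square of the coboundary appears.\<close>

lemma sum_symmetric_bit:
  fixes F :: "'x \<Rightarrow> 'x \<Rightarrow> bit"
  assumes "\<And>x y. F x y = F y x" "\<And>x. F x x = 0"
  shows "(\<Sum>x\<in>I. \<Sum>y\<in>I. F x y) = 0"
proof (induction I rule: infinite_finite_induct)
  case (insert z I)
  have "(\<Sum>x\<in>insert z I. \<Sum>y\<in>insert z I. F x y)
      = F z z + (\<Sum>y\<in>I. F z y) + ((\<Sum>x\<in>I. F x z) + (\<Sum>x\<in>I. \<Sum>y\<in>I. F x y))"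
    using insert by (simp add: sum.distrib)
  also have "(\<Sum>x\<in>I. F x z) = (\<Sum>y\<in>I. F z y)"
    using assms(1) by metis
  finally show ?case
    using insert assms(2) by (simp add: add.assoc[symmetric])
qed auto

text \<open>The two values on an orbit \<open>{x, \<phi> x}\<close> cancel; the induction removes
  one orbit at a time.\<close>

lemma sum_bit_involution:
  fixes g :: "'x \<Rightarrow> bit"
  assumes "finite S"
    and "\<And>x. x \<in> S \<Longrightarrow> \<phi> x \<in> S \<and> \<phi> (\<phi> x) = x \<and> \<phi> x \<noteq> x \<and> g (\<phi> x) = g x"
  shows "sum g S = 0"
  using assms
proof (induction "card S" arbitrary: S rule: less_induct)
  case less
  show ?case
  proof (cases "S = {}")
    case False
    then obtain x where x: "x \<in> S" by auto
    let ?T = "S - {x, \<phi> x}"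
    have p: "\<phi> x \<in> S" "\<phi> (\<phi> x) = x" "\<phi> x \<noteq> x" "g (\<phi> x) = g x"
      using less.prems(2)[OF x] by auto
    have "card ?T < card S"
      using x less.prems(1) by (intro psubset_card_mono) auto
    moreover have "\<phi> y \<in> ?T \<and> \<phi> (\<phi> y) = y \<and> \<phi> y \<noteq> y \<and> g (\<phi> y) = g y" if "y \<in> ?T" for y
      using less.prems(2)[of y] that p by (auto; metis)
    ultimately have "sum g ?T = 0"
      using less.hyps[of ?T] less.prems(1) by blast
    moreover have "sum g S = sum g ?T + sum g {x, \<phi> x}"
      using less.prems(1) x p(1) by (intro sum.subset_diff) auto
    ultimately show ?thesis
      using p by auto
  qed auto
qed

text \<open>An even coordinate stands for an interval whose end points are the two odd neighbours,
  so these are the two facets of \<open>v\<close> in direction \<open>x\<close>; an odd coordinate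
  has none. Cochains are functions on all integer vectors at once, without a grading by
  dimension.\<close>

definition coface_sum :: "'x \<Rightarrow> (('x \<Rightarrow> int) \<Rightarrow> bit) \<Rightarrow> ('x \<Rightarrow> int) \<Rightarrow> bit" where
  "coface_sum x h v = (if even (v x) then h (v(x := v x + 1)) + h (v(x := v x - 1)) else 0)"

definition cobd :: "'x set \<Rightarrow> (('x \<Rightarrow> int) \<Rightarrow> bit) \<Rightarrow> ('x \<Rightarrow> int) \<Rightarrow> bit" where
  "cobd I h v = (\<Sum>x\<in>I. coface_sum x h v)"

lemma cobd_add: "cobd I (\<lambda>u. g u + h u) v = cobd I g v + cobd I h v"
  unfolding cobd_def coface_sum_def sum.distrib[symmetric]
  by (intro sum.cong) (auto simp: algebra_simps)

lemma cobd_sum: "cobd I (\<lambda>u. \<Sum>e\<in>E. g e u) v = (\<Sum>e\<in>E. cobd I (g e) v)"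
proof (induction E rule: infinite_finite_induct)
  case (insert e E)
  then show ?case by (simp add: cobd_add)
qed (simp_all add: cobd_def coface_sum_def cong: if_cong)

lemma cobd_const: "cobd I (\<lambda>_. c) v = 0"
  by (simp add: cobd_def coface_sum_def cong: if_cong)

lemma coface_sum_commute:
  "x \<noteq> y \<Longrightarrow> coface_sum x (coface_sum y h) v = coface_sum y (coface_sum x h) v"
  by (simp add: coface_sum_def fun_upd_twist[of x y] add_ac)

lemma coface_sum_self: "coface_sum x (coface_sum x h) v = 0"
  by (simp add: coface_sum_def)

text \<open>Different directions commute, and repeating a direction meets an odd coordinate, so the
  double sum is symmetric with zero diagonal.\<close>

lemma cobd_cobd: "cobd I (cobd I h) v = 0"
proof -
  have "coface_sum x (cobd I h) v = (\<Sum>y\<in>I. coface_sum x (coface_sum y h) v)" for x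
    by (simp add: cobd_def coface_sum_def sum.distrib)
  then have "cobd I (cobd I h) v = (\<Sum>x\<in>I. \<Sum>y\<in>I. coface_sum x (coface_sum y h) v)"
    by (simp add: cobd_def)
  also have "\<dots> = 0"
    by (rule sum_symmetric_bit) (metis coface_sum_commute, rule coface_sum_self)
  finally show ?thesis .
qed

text \<open>Polynomials over the field with two elements are finitely supported functions on
  exponent functions, multiplied by convolution. The exponent functions themselves are arbitrary, so
  that they add pointwise.\<close>

definition X :: "nat \<Rightarrow> (nat \<Rightarrow> nat) \<Rightarrow>\<^sub>0 bit" where
  "X i = Poly_Mapping.single (\<lambda>l. of_bool (l = i)) 1"

lemma X_power: "X i ^ n = Poly_Mapping.single (\<lambda>l. if l = i then n else 0) 1"
proof (induction n)
  case 0
  show ?case by (simp add: zero_fun_def[symmetric])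
next
  case (Suc n)
  have "(\<lambda>l. of_bool (l = i)) + (\<lambda>l. if l = i then n else 0) = (\<lambda>l. if l = i then Suc n else 0)"
    by (auto simp: fun_eq_iff)
  then show ?case
    unfolding power_Suc Suc unfolding X_def mult_single by simp
qed

lemma prod_X_power:
  assumes "finite A"
  shows "(\<Prod>i\<in>A. X i ^ n) = Poly_Mapping.single (\<lambda>l. if l \<in> A then n else 0) 1"
  using assms
proof (induction A)
  case empty
  show ?case by (simp add: zero_fun_def[symmetric])
next
  case (insert i A)
  have "(\<lambda>l. if l = i then n else 0) + (\<lambda>l. if l \<in> A then n else 0)
      = (\<lambda>l. if l \<in> insert i A then n else 0)"
    using insert by (auto simp: fun_eq_iff)
  then show ?case
    using insert by (simp add: X_power mult_single)
qed

section \<open>The cubical grid and its sign changes\<close>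

type_synonym cell = "nat \<times> nat \<Rightarrow> int"

text \<open>
  A cell is a vector of integers: an odd coordinate is a vertex of the grid, an even one the open
  interval between its two neighbours. The coordinates \<open>(i, a)\<close> with fixed \<open>i\<close> form the \<open>i\<close>-th factor,
  the boundary of a cube in dimension \<open>d + 1\<close>. As \<open>M\<close> is odd, a vertex has no coordinate \<open>0\<close>.
\<close>

locale cube_grid =
  fixes k d :: nat and M :: int
  assumes M_odd: "odd M" and M_pos: "M > 0"
begin

definition coords :: "(nat \<times> nat) set" where
  "coords = {1..k} \<times> {..d}"

definition cells :: "cell set" where
  "cells = {v. (\<forall>x. x \<notin> coords \<longrightarrow> v x = 0) \<and> (\<forall>x\<in>coords. \<bar>v x\<bar> \<le> M) \<and>
     (\<forall>i\<in>{1..k}. \<exists>a\<le>d. \<bar>v (i, a)\<bar> = M)}"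

definition neg :: "nat \<Rightarrow> cell \<Rightarrow> cell" where
  "neg i v = (\<lambda>x. if fst x = i then - v x else v x)"

definition invariant :: "(cell \<Rightarrow> bit) \<Rightarrow> bool" where
  "invariant h \<longleftrightarrow> (\<forall>i\<in>{1..k}. \<forall>v\<in>cells. h (neg i v) = h v)"

text \<open>Such an \<epsilon> takes values on cells of every dimension, and the bit
  \<open>\<epsilon> u + \<epsilon> v\<close> of a pair of cells is invariant under a simultaneous
  sign change. On the quotient it gives a class of degree one, the linear form
  \<open>\<Sum>i\<in>A. X i\<close>.\<close>

definition equivariant :: "nat set \<Rightarrow> (cell \<Rightarrow> bit) \<Rightarrow> bool" where
  "equivariant A \<epsilon> \<longleftrightarrow> (\<forall>i\<in>{1..k}. \<forall>v\<in>cells. \<epsilon> (neg i v) = \<epsilon> v + of_bool (i \<in> A))"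

abbreviation \<delta> :: "(cell \<Rightarrow> bit) \<Rightarrow> cell \<Rightarrow> bit" where
  "\<delta> \<equiv> cobd coords"

lemma finite_coords [simp]: "finite coords"
  by (simp add: coords_def)

text \<open>As \<open>M\<close> is odd, an even coordinate is never one that puts the cell on the
  cube boundary, and it has room to move by one.\<close>

lemma face_in_cells:
  assumes v: "v \<in> cells" and x: "x \<in> coords" "even (v x)" and s: "s = 1 \<or> s = -1"
  shows "v(x := v x + s) \<in> cells"
proof -
  have ne: "\<bar>v x\<bar> \<noteq> M"
    using x M_odd by auto
  have "\<bar>v x\<bar> \<le> M" using v x by (auto simp: cells_def)
  then have le: "\<bar>v x + s\<bar> \<le> M" using ne s by auto
  have "\<exists>a\<le>d. \<bar>(v(x := v x + s)) (i, a)\<bar> = M" if "i \<in> {1..k}" for i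
  proof -
    obtain a where "a \<le> d" "\<bar>v (i, a)\<bar> = M"
      using v \<open>i \<in> {1..k}\<close> unfolding cells_def by blast
    then show ?thesis
      using ne by (intro exI[of _ a]) auto
  qed
  then show ?thesis
    using v x le by (auto simp: cells_def)
qed

lemma cobd_cong:
  assumes "v \<in> cells" "\<And>u. u \<in> cells \<Longrightarrow> g u = h u"
  shows "\<delta> g v = \<delta> h v"
  unfolding cobd_def coface_sum_def
proof (intro sum.cong refl if_cong)
  fix x assume "x \<in> coords" "even (v x)"
  then show "g (v(x := v x + 1)) + g (v(x := v x - 1)) = h (v(x := v x + 1)) + h (v(x := v x - 1))"
    using face_in_cells[OF assms(1), of x 1] face_in_cells[OF assms(1), of x "-1"] assms(2) by simp
qed

lemma cobd_neg: "\<delta> h (neg i v) = \<delta> (\<lambda>u. h (neg i u)) v"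
  unfolding cobd_def
proof (intro sum.cong refl)
  fix x
  have "(neg i v)(x := neg i v x + 1) = neg i (v(x := v x + (if fst x = i then -1 else 1)))"
    and "(neg i v)(x := neg i v x - 1) = neg i (v(x := v x - (if fst x = i then -1 else 1)))"
    by (auto simp: neg_def fun_eq_iff)
  then show "coface_sum x h (neg i v) = coface_sum x (\<lambda>u. h (neg i u)) v"
    unfolding coface_sum_def by (cases "fst x = i") (simp_all add: add.commute, simp_all add: neg_def)
qed

lemma invariant_add: "invariant g \<Longrightarrow> invariant h \<Longrightarrow> invariant (\<lambda>u. g u + h u)"
  by (simp add: invariant_def)

text \<open>The combination is the sum of \<open>(\<epsilon> u + \<epsilon> v) * h u\<close> over
  the facets \<open>u\<close> of \<open>v\<close>, and the first factor is invariant. It serves as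
  the cup product of the coboundary of \<epsilon> with \<open>h\<close>.\<close>

lemma invariant_commutator:
  assumes "invariant h" "equivariant A \<epsilon>"
  shows "invariant (\<lambda>v. \<delta> (\<lambda>u. \<epsilon> u * h u) v + \<epsilon> v * \<delta> h v)"
  unfolding invariant_def
proof (intro ballI)
  fix i v assume i: "i \<in> {1..k}" and v: "v \<in> cells"
  let ?b = "of_bool (i \<in> A) :: bit"
  have \<epsilon>: "\<epsilon> (neg i u) = \<epsilon> u + ?b" "h (neg i u) = h u" if "u \<in> cells" for u
    using assms i that by (auto simp: equivariant_def invariant_def)
  have "\<delta> (\<lambda>u. \<epsilon> u * h u) (neg i v) = \<delta> (\<lambda>u. \<epsilon> u * h u + ?b * h u) v"
    unfolding cobd_neg by (intro cobd_cong[OF v]) (simp add: \<epsilon> algebra_simps)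
  also have "\<dots> = \<delta> (\<lambda>u. \<epsilon> u * h u) v + ?b * \<delta> h v"
    by (cases "i \<in> A") (simp_all add: cobd_add cobd_const)
  finally have 1: "\<delta> (\<lambda>u. \<epsilon> u * h u) (neg i v) = \<delta> (\<lambda>u. \<epsilon> u * h u) v + ?b * \<delta> h v" .
  have 2: "\<delta> h (neg i v) = \<delta> h v"
    unfolding cobd_neg by (intro cobd_cong[OF v]) (simp add: \<epsilon>)
  show "\<delta> (\<lambda>u. \<epsilon> u * h u) (neg i v) + \<epsilon> (neg i v) * \<delta> h (neg i v)
      = \<delta> (\<lambda>u. \<epsilon> u * h u) v + \<epsilon> v * \<delta> h v"
    unfolding 1 2 \<epsilon>(1)[OF v] by (simp add: algebra_simps)
qed

section \<open>Cohomology modulo the sign changes, and evaluation on the top cells\<close>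

definition cohomologous :: "(cell \<Rightarrow> bit) \<Rightarrow> (cell \<Rightarrow> bit) \<Rightarrow> bool" where
  "cohomologous g h \<longleftrightarrow> (\<exists>\<beta>. invariant \<beta> \<and> (\<forall>v\<in>cells. g v = h v + \<delta> \<beta> v))"

text \<open>The cup product depends only on \<open>A\<close> and on the class of \<open>g\<close>:
  \<open>\<epsilon> u + \<epsilon>' u\<close> is invariant because both summands change under the
  same generators, and a coboundary in \<open>g\<close> is absorbed by
  \<open>invariant_commutator\<close>.\<close>

lemma cohomologous_cup:
  assumes "cohomologous g h" "invariant g" "equivariant A \<epsilon>" "equivariant A \<epsilon>'"
  shows "cohomologous (\<delta> (\<lambda>u. \<epsilon> u * g u)) (\<delta> (\<lambda>u. \<epsilon>' u * h u))"
proof -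
  obtain \<beta> where \<beta>: "invariant \<beta>" "\<And>v. v \<in> cells \<Longrightarrow> g v = h v + \<delta> \<beta> v"
    using assms(1) by (auto simp: cohomologous_def)
  \<comment> \<open>The cochain \<open>\<epsilon>' u * \<delta> \<beta> u\<close> alone need not be
    invariant; the coboundary added to it repairs this and is killed by \<delta>.\<close>
  define \<gamma> where "\<gamma> = (\<lambda>u. (\<epsilon> u + \<epsilon>' u) * g u + (\<delta> (\<lambda>u. \<epsilon>' u * \<beta> u) u + \<epsilon>' u * \<delta> \<beta> u))"
  have "invariant (\<lambda>u. (\<epsilon> u + \<epsilon>' u) * g u)"
    using assms by (auto simp: invariant_def equivariant_def algebra_simps)
  then have "invariant \<gamma>"
    unfolding \<gamma>_def using invariant_commutator[OF \<beta>(1) assms(4)] by (rule invariant_add)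
  moreover have "\<delta> (\<lambda>u. \<epsilon> u * g u) v = \<delta> (\<lambda>u. \<epsilon>' u * h u) v + \<delta> \<gamma> v" if v: "v \<in> cells" for v
  proof -
    have "\<delta> (\<lambda>u. \<epsilon> u * g u) v
        = \<delta> (\<lambda>u. \<epsilon>' u * h u + ((\<epsilon> u + \<epsilon>' u) * g u + \<epsilon>' u * \<delta> \<beta> u)) v"
    proof (rule cobd_cong[OF v])
      fix u assume "u \<in> cells"
      then show "\<epsilon> u * g u = \<epsilon>' u * h u + ((\<epsilon> u + \<epsilon>' u) * g u + \<epsilon>' u * \<delta> \<beta> u)"
        using \<beta>(2)[of u] by (cases "\<epsilon> u"; cases "\<epsilon>' u"; cases "h u"; cases "\<delta> \<beta> u") auto
    qed
    also have "\<dots> = \<delta> (\<lambda>u. \<epsilon>' u * h u) v + \<delta> \<gamma> v"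
      unfolding \<gamma>_def cobd_add cobd_cobd by simp
    finally show ?thesis .
  qed
  ultimately show ?thesis
    by (auto simp: cohomologous_def)
qed

text \<open>Representatives of the cells of full dimension modulo the sign changes.\<close>

definition top_cells :: "cell set" where
  "top_cells = {v. (\<forall>x. x \<notin> coords \<longrightarrow> v x = 0) \<and>
     (\<forall>i\<in>{1..k}. \<exists>a\<le>d. v (i, a) = M \<and> (\<forall>b\<le>d. b \<noteq> a \<longrightarrow> even (v (i, b)) \<and> \<bar>v (i, b)\<bar> < M))}"

lemma top_cells_subset: "top_cells \<subseteq> cells"
proof
  fix v assume v: "v \<in> top_cells"
  have "\<bar>v x\<bar> \<le> M" if x: "x \<in> coords" for x
  proof -
    obtain i b where [simp]: "x = (i, b)" and ib: "i \<in> {1..k}" "b \<le> d"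
      using x by (auto simp: coords_def)
    obtain a where "a \<le> d" "v (i, a) = M" "\<forall>b\<le>d. b \<noteq> a \<longrightarrow> even (v (i, b)) \<and> \<bar>v (i, b)\<bar> < M"
      using v ib unfolding top_cells_def by blast
    then show ?thesis using ib M_pos by (cases "b = a") auto
  qed
  moreover have "\<exists>a\<le>d. \<bar>v (i, a)\<bar> = M" if i: "i \<in> {1..k}" for i
  proof -
    obtain a where "a \<le> d" "v (i, a) = M"
      using v i unfolding top_cells_def by blast
    then show ?thesis using M_pos by auto
  qed
  moreover have "v x = 0" if "x \<notin> coords" for x
    using v that unfolding top_cells_def by blast
  ultimately show "v \<in> cells"
    by (simp add: cells_def)
qed

lemma finite_cells: "finite cells"
proof -
  have "cells \<subseteq> {v. \<forall>x. (x \<in> coords \<longrightarrow> v x \<in> {-M..M}) \<and> (x \<notin> coords \<longrightarrow> v x = 0)}"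
    by (force simp: cells_def)
  moreover have "finite {v. \<forall>x. (x \<in> coords \<longrightarrow> v x \<in> {-M..M}) \<and> (x \<notin> coords \<longrightarrow> v x = (0::int))}"
    by (rule finite_set_of_finite_funs) auto
  ultimately show ?thesis by (rule finite_subset)
qed

lemma finite_top_cells [simp]: "finite top_cells"
  using top_cells_subset finite_cells by (rule finite_subset)

definition pos :: "cell \<Rightarrow> nat \<Rightarrow> nat" where
  "pos v i = (THE a. a \<le> d \<and> v (i, a) = M)"

lemma pos_eq:
  assumes "v \<in> top_cells" "i \<in> {1..k}" "a \<le> d" "v (i, a) = M"
  shows "pos v i = a"
  unfolding pos_def
proof (rule the_equality)
  fix b assume b: "b \<le> d \<and> v (i, b) = M"
  obtain c where "\<forall>b\<le>d. b \<noteq> c \<longrightarrow> even (v (i, b)) \<and> \<bar>v (i, b)\<bar> < M"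
    using assms(1,2) unfolding top_cells_def by blast
  then have "\<forall>b\<le>d. v (i, b) = M \<longrightarrow> b = c"
    using M_odd by blast
  then show "b = a"
    using b assms(3,4) by blast
qed (use assms in auto)

lemma pos:
  assumes "v \<in> top_cells" "i \<in> {1..k}"
  shows "pos v i \<le> d" "v (i, pos v i) = M"
    and "\<And>b. b \<le> d \<Longrightarrow> b \<noteq> pos v i \<Longrightarrow> even (v (i, b)) \<and> \<bar>v (i, b)\<bar> < M"
proof -
  obtain a where a: "a \<le> d" "v (i, a) = M" "\<forall>b\<le>d. b \<noteq> a \<longrightarrow> even (v (i, b)) \<and> \<bar>v (i, b)\<bar> < M"
    using assms unfolding top_cells_def by blast
  then have "pos v i = a"
    using assms by (intro pos_eq)
  then show "pos v i \<le> d" "v (i, pos v i) = M"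
    and "\<And>b. b \<le> d \<Longrightarrow> b \<noteq> pos v i \<Longrightarrow> even (v (i, b)) \<and> \<bar>v (i, b)\<bar> < M"
    using a by auto
qed

lemma top_cells_update:
  assumes "v \<in> top_cells" "i \<in> {1..k}" "\<And>x. fst x \<noteq> i \<Longrightarrow> w x = v x"
    and "\<And>b. b > d \<Longrightarrow> w (i, b) = 0"
    and "a \<le> d" "w (i, a) = M"
    and "\<And>b. b \<le> d \<Longrightarrow> b \<noteq> a \<Longrightarrow> even (w (i, b)) \<and> \<bar>w (i, b)\<bar> < M"
  shows "w \<in> top_cells"
proof -
  have "w x = 0" if "x \<notin> coords" for x
  proof (cases "fst x = i")
    case True
    then show ?thesis using that assms(2,4) by (cases x) (auto simp: coords_def)
  next
    case False
    then have "w x = v x" by (rule assms(3))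
    also have "v x = 0" using assms(1) that unfolding top_cells_def by blast
    finally show ?thesis .
  qed
  moreover have "\<exists>a\<le>d. w (l, a) = M \<and> (\<forall>b\<le>d. b \<noteq> a \<longrightarrow> even (w (l, b)) \<and> \<bar>w (l, b)\<bar> < M)"
    if "l \<in> {1..k}" for l
  proof (cases "l = i")
    case True
    then show ?thesis using assms by auto
  next
    case False
    then have "\<And>b. w (l, b) = v (l, b)" using assms(3) by simp
    then show ?thesis using assms(1) that by (simp add: top_cells_def)
  qed
  ultimately show ?thesis by (simp add: top_cells_def)
qed

text \<open>Every cell of codimension one, taken up to the sign changes \<open>neg\<close>, is a face of exactly two
  top cells; the involution exchanges them.\<close>

lemma sum_top_cells_cobd:
  assumes "invariant \<beta>"
  shows "(\<Sum>v\<in>top_cells. \<delta> \<beta> v) = 0"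
proof -
  \<comment> \<open>\<open>S\<close> lists the incidences of top cells with their facets, by
    direction and side. If the moved coordinate stays inside the cube facet, the other top cell lies
    across it. If it reaches \<open>M\<close>, the facet lies on a ridge of the cube, and the
    coordinates \<open>x\<close> and \<open>y\<close> exchange roles. If it reaches
    \<open>-M\<close>, a negation is needed to return to the chosen representatives.\<close>
  define S where "S = Sigma top_cells (\<lambda>v. {x \<in> coords. even (v x)} \<times> {1, -1::int})"
  define g where "g = (\<lambda>(v, x, s). \<beta> (v(x := v x + s)))"
  define \<phi> where "\<phi> = (\<lambda>(v :: cell, x :: nat \<times> nat, s :: int).
    let u = v x + s; y = (fst x, pos v (fst x)) in
    if \<bar>u\<bar> < M then (v(x := u + s), x, - s)
    else if u = M then (v(x := M, y := M - 1), y, 1)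
    else ((neg (fst x) v)(x := M, y := 1 - M), y, -1))"
  have "(\<Sum>v\<in>top_cells. \<delta> \<beta> v) = (\<Sum>v\<in>top_cells. \<Sum>p\<in>{x \<in> coords. even (v x)} \<times> {1, -1}. g (v, p))"
  proof (intro sum.cong refl)
    fix v
    have "\<delta> \<beta> v = (\<Sum>x\<in>{x \<in> coords. even (v x)}. \<beta> (v(x := v x + 1)) + \<beta> (v(x := v x - 1)))"
      by (simp add: cobd_def coface_sum_def sum.inter_filter)
    also have "\<dots> = (\<Sum>x\<in>{x \<in> coords. even (v x)}. \<Sum>s\<in>{1, -1}. g (v, x, s))"
      by (simp add: g_def)
    also have "\<dots> = (\<Sum>p\<in>{x \<in> coords. even (v x)} \<times> {1, -1}. g (v, p))"
      unfolding sum.cartesian_product by (intro sum.cong) auto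
    finally show "\<delta> \<beta> v = (\<Sum>p\<in>{x \<in> coords. even (v x)} \<times> {1, -1}. g (v, p))" .
  qed
  also have "\<dots> = sum g S"
    unfolding S_def by (subst sum.Sigma) auto
  also have "\<dots> = 0"
  proof (rule sum_bit_involution[where \<phi> = \<phi>])
    show "finite S" by (simp add: S_def)
    fix p assume "p \<in> S"
    then obtain v x s where p: "p = (v, x, s)" and v: "v \<in> top_cells" and x: "x \<in> coords"
      and ev: "even (v x)" and s: "s = 1 \<or> s = -1"
      by (auto simp: S_def)
    obtain i b where xb: "x = (i, b)" and i: "i \<in> {1..k}" and b: "b \<le> d"
      using x by (auto simp: coords_def)
    define a where "a = pos v i"
    note v_pos = pos[OF v i, folded a_def]
    have ba: "b \<noteq> a"
      using ev v_pos(2) M_odd xb by auto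
    have lt: "\<bar>v x\<bar> < M"
      using v_pos(3)[OF b ba] xb by simp
    have out: "v (i, c) = 0" if "c > d" for c
      using v that by (simp add: top_cells_def coords_def)
    have inS: "(w, y, r) \<in> S" if "w \<in> top_cells" "y \<in> coords" "even (w y)" "r = 1 \<or> r = -1" for w y r
      using that by (auto simp: S_def)
    have a_coords: "(i, a) \<in> coords"
      using i v_pos(1) by (simp add: coords_def)
    consider "\<bar>v x + s\<bar> < M" | "v x = M - 1" "s = 1" | "v x = 1 - M" "s = -1"
      using lt s by linarith
    then show "\<phi> p \<in> S \<and> \<phi> (\<phi> p) = p \<and> \<phi> p \<noteq> p \<and> g (\<phi> p) = g p"
    proof cases
      case 1
      \<comment> \<open>An odd number of absolute value below the odd \<open>M\<close> is at most
        \<open>M - 2\<close> in absolute value, so one more step stays below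
        \<open>M\<close>.\<close>
      have "odd (v x + s)" using ev s by auto
      then have "\<bar>v x + s + s\<bar> < M"
        using 1 s M_odd ev by (smt (verit) even_add even_minus)
      then have "v(x := v x + s + s) \<in> top_cells"
        using v i v_pos out b ba s ev xb by (intro top_cells_update[OF v i, where a = a]) auto
      moreover have "\<phi> p = (v(x := v x + s + s), x, - s)"
        using 1 by (simp add: \<phi>_def p Let_def)
      moreover from this have "\<phi> (\<phi> p) = p"
        using 1 by (simp add: \<phi>_def p Let_def add.commute)
      ultimately show ?thesis
        using s x ev by (auto simp: p g_def add.commute intro!: inS)
    next
      case 2
      define w where "w = v(x := M, (i, a) := M - 1)"
      have w: "w \<in> top_cells"
        using v_pos out b ba xb M_odd M_pos
        by (intro top_cells_update[OF v i, where a = b]) (auto simp: w_def)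
      have "pos w i = b"
        using ba xb by (intro pos_eq[OF w i b]) (auto simp: w_def)
      moreover have \<phi>: "\<phi> p = (w, (i, a), 1)"
        using 2 xb by (simp add: \<phi>_def p w_def a_def Let_def)
      ultimately have "\<phi> (\<phi> p) = p"
        using 2 xb ba v_pos(2) by (auto simp: \<phi>_def p w_def a_def Let_def fun_eq_iff)
      moreover have "g (\<phi> p) = g p"
        unfolding \<phi> unfolding p g_def w_def using 2 xb ba v_pos(2)
        by (auto intro!: arg_cong[of _ _ \<beta>] simp: fun_eq_iff)
      ultimately show ?thesis
        using ba xb w a_coords M_odd unfolding \<phi> by (auto simp: p w_def intro!: inS)
    next
      case 3
      define w where "w = (neg i v)(x := M, (i, a) := 1 - M)"
      have w: "w \<in> top_cells"
        using v_pos out b ba xb M_odd M_pos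
        by (intro top_cells_update[OF v i, where a = b]) (auto simp: w_def neg_def)
      have "pos w i = b"
        using ba xb by (intro pos_eq[OF w i b]) (auto simp: w_def)
      moreover have \<phi>: "\<phi> p = (w, (i, a), -1)"
        using 3 xb M_pos by (simp add: \<phi>_def p w_def a_def Let_def)
      ultimately have "\<phi> (\<phi> p) = p"
        using 3 xb ba v_pos(2) M_pos
        by (auto simp: \<phi>_def p w_def a_def Let_def fun_eq_iff neg_def)
      moreover have "g (\<phi> p) = g p"
      proof -
        have "v(x := v x + s) \<in> cells"
          using top_cells_subset v x ev s by (intro face_in_cells) auto
        then have "\<beta> (neg i (v(x := v x + s))) = \<beta> (v(x := v x + s))"
          using assms i by (simp add: invariant_def)
        moreover have "w((i, a) := w (i, a) + - 1) = neg i (v(x := v x + s))"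
          using 3 xb ba v_pos(2) by (auto simp: w_def neg_def fun_eq_iff)
        ultimately show ?thesis
          unfolding \<phi> unfolding p g_def by simp
      qed
      ultimately show ?thesis
        using ba xb w a_coords M_odd unfolding \<phi> by (auto simp: p w_def intro!: inS)
    qed
  qed
  finally show ?thesis .
qed

section \<open>Cochains representing polynomials\<close>

definition gen :: "nat \<Rightarrow> cell \<Rightarrow> bit" where
  "gen i v = of_bool (v (i, LEAST a. v (i, a) \<noteq> 0) > 0)"

text \<open>The cochain \<open>mono_cochain e\<close> represents the monomial \<open>\<Prod>i. X i ^ e i\<close>: it is dual to a product of
  coordinate subspheres of codimensions \<open>e i\<close>.\<close>

definition mono_cochain :: "(nat \<Rightarrow> nat) \<Rightarrow> cell \<Rightarrow> bit" where
  "mono_cochain e v = of_bool (\<forall>i\<in>{1..k}. \<forall>a\<le>d. if a < e i then v (i, a) = 0 else odd (v (i, a)))"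

lemma cells_nonzero:
  assumes "v \<in> cells" "i \<in> {1..k}"
  obtains a where "a \<le> d" "v (i, a) \<noteq> 0"
proof -
  obtain a where "a \<le> d" "\<bar>v (i, a)\<bar> = M"
    using assms unfolding cells_def by blast
  then show ?thesis using M_pos that by auto
qed

text \<open>Every block of a cell has a nonzero coordinate, and the sign of the first one flips
  exactly under the negation of that block.\<close>

lemma equivariant_gen:
  assumes i: "i \<in> {1..k}"
  shows "equivariant {i} (gen i)"
  unfolding equivariant_def
proof (intro ballI)
  fix l v assume l: "l \<in> {1..k}" and v: "v \<in> cells"
  let ?a = "LEAST a. v (i, a) \<noteq> 0"
  obtain a where "v (i, a) \<noteq> 0"
    using cells_nonzero[OF v i] by metis
  then have "v (i, ?a) \<noteq> 0" by (rule LeastI)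
  then show "gen i (neg l v) = gen i v + of_bool (l \<in> {i})"
    by (cases "l = i") (auto simp: gen_def neg_def)
qed

lemma equivariant_sum_gen:
  assumes "A \<subseteq> {1..k}"
  shows "equivariant A (\<lambda>u. \<Sum>i\<in>A. gen i u)"
  unfolding equivariant_def
proof (intro ballI)
  fix i v assume i: "i \<in> {1..k}" and v: "v \<in> cells"
  have "(\<Sum>l\<in>A. gen l (neg i v)) = (\<Sum>l\<in>A. gen l v + of_bool (i = l))"
  proof (rule sum.cong)
    fix l assume "l \<in> A"
    then have "equivariant {l} (gen l)" using assms by (intro equivariant_gen) auto
    then show "gen l (neg i v) = gen l v + of_bool (i = l)"
      using i v by (simp add: equivariant_def)
  qed simp
  also have "\<dots> = (\<Sum>l\<in>A. gen l v) + of_bool (i \<in> A)"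
    using finite_subset[OF assms] by (simp add: sum.distrib of_bool_def)
  finally show "(\<Sum>l\<in>A. gen l (neg i v)) = (\<Sum>l\<in>A. gen l v) + of_bool (i \<in> A)" .
qed

text \<open>All \<open>d + 1\<close> coordinates of block \<open>i\<close> would have to vanish,
  which is impossible on the boundary of the cube.\<close>

lemma mono_cochain_eq_0:
  assumes "v \<in> cells" "i \<in> {1..k}" "e i > d"
  shows "mono_cochain e v = 0"
proof -
  obtain a where "a \<le> d" "v (i, a) \<noteq> 0"
    using cells_nonzero[OF assms(1,2)] by metis
  then have "\<not> (if a < e i then v (i, a) = 0 else odd (v (i, a)))"
    using assms(3) by auto
  then have "\<not> (\<forall>i\<in>{1..k}. \<forall>a\<le>d. if a < e i then v (i, a) = 0 else odd (v (i, a)))"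
    using \<open>a \<le> d\<close> assms(2) by blast
  then show ?thesis by (simp add: mono_cochain_def)
qed

text \<open>On the support of \<open>mono_cochain e\<close> the first nonzero coordinate of block
  \<open>i\<close> is the odd one at position \<open>e i\<close>, so \<open>gen i\<close> is its
  sign. Both facets of \<open>v\<close> in direction \<open>x\<close> have the same monomial value
  and cancel unless this sign differs, that is, unless \<open>x = (i, e i)\<close> and
  \<open>v x = 0\<close>; this is the support condition for the raised exponent.\<close>

lemma coface_sum_gen_mono:
  assumes i: "i \<in> {1..k}" and e: "e i \<le> d" and x: "x \<in> coords"
  shows "coface_sum x (\<lambda>u. gen i u * mono_cochain e u) v
       = (if x = (i, e i) then mono_cochain (e(i := e i + 1)) v else 0)"
proof -
  define P where "P = (\<lambda>e v. \<forall>i\<in>{1..k}. \<forall>a\<le>d. if a < e i then v (i, a) = 0 else odd (v (i, a) :: int))"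
  have mono: "mono_cochain e v = of_bool (P e v)" for e v
    by (simp add: mono_cochain_def P_def)
  obtain j b where xj: "x = (j, b)" "j \<in> {1..k}" "b \<le> d"
    using x by (auto simp: coords_def)
  show ?thesis
  proof (cases "even (v x)")
    case False
    then have "\<not> P (e(i := e i + 1)) v" if "x = (i, e i)"
      using that i e unfolding P_def by (auto intro!: bexI[of _ i] exI[of _ "e i"])
    then show ?thesis using False by (simp add: coface_sum_def mono)
  next
    case True
    let ?u = "v(x := v x + 1)" and ?w = "v(x := v x - 1)"
    have least: "gen i u = of_bool (u (i, e i) > 0)" if "P e u" for u
    proof -
      have *: "\<forall>a\<le>d. if a < e i then u (i, a) = 0 else odd (u (i, a))"
        using that i unfolding P_def by blast
      have "(LEAST a. u (i, a) \<noteq> 0) = e i"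
      proof (rule Least_equality)
        show "u (i, e i) \<noteq> 0" using * e by (metis even_zero less_irrefl)
        show "e i \<le> a" if "u (i, a) \<noteq> 0" for a
          using * e that by (metis le_less_trans linorder_not_less less_imp_le_nat)
      qed
      then show ?thesis by (simp add: gen_def)
    qed
    have uw: "P e ?u \<longleftrightarrow> P e ?w"
    proof -
      have "(if a < e l then ?u (l, a) = 0 else odd (?u (l, a)))
          \<longleftrightarrow> (if a < e l then ?w (l, a) = 0 else odd (?w (l, a)))" for l a
        using True by (cases "x = (l, a)") (auto, presburger+)
      then show ?thesis unfolding P_def by simp
    qed
    have main: "P (e(i := e i + 1)) v \<longleftrightarrow> P e ?u \<and> v x = 0" if "x = (i, e i)"
    proof
      assume *: "P (e(i := e i + 1)) v"
      then have "\<forall>a\<le>d. if a < e i + 1 then v (i, a) = 0 else odd (v (i, a))"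
        using i unfolding P_def by fastforce
      then have "v x = 0" using e that by simp
      moreover have "if a < e l then ?u (l, a) = 0 else odd (?u (l, a))" if "l \<in> {1..k}" "a \<le> d" for l a
      proof -
        have "if a < (e(i := e i + 1)) l then v (l, a) = 0 else odd (v (l, a))"
          using * that unfolding P_def by blast
        then show ?thesis
          using \<open>v x = 0\<close> \<open>x = (i, e i)\<close> by (auto split: if_splits)
      qed
      ultimately show "P e ?u \<and> v x = 0" unfolding P_def by blast
    next
      assume *: "P e ?u \<and> v x = 0"
      have "if a < (e(i := e i + 1)) l then v (l, a) = 0 else odd (v (l, a))" if "l \<in> {1..k}" "a \<le> d" for l a
      proof -
        have "if a < e l then ?u (l, a) = 0 else odd (?u (l, a))"
          using * that unfolding P_def by blast
        then show ?thesis
          using * \<open>x = (i, e i)\<close> by (auto split: if_splits)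
      qed
      then show "P (e(i := e i + 1)) v" unfolding P_def by blast
    qed
    show ?thesis
    proof (cases "P e ?u")
      case False
      have "x = (i, e i) \<Longrightarrow> \<not> P (e(i := e i + 1)) v" using main False by blast
      moreover have "coface_sum x (\<lambda>u. gen i u * mono_cochain e u) v = 0"
        using False uw by (simp add: coface_sum_def mono)
      ultimately show ?thesis by (cases "x = (i, e i)") (simp_all add: mono)
    next
      case P: True
      have "coface_sum x (\<lambda>u. gen i u * mono_cochain e u) v
          = of_bool (?u (i, e i) > 0) + of_bool (?w (i, e i) > 0)"
        using True P uw least by (simp add: coface_sum_def mono)
      also have "\<dots> = of_bool (x = (i, e i) \<and> v x = 0)"
      proof (cases "x = (i, e i)")
        case x: True
        have "(v x + 1 > 0) \<noteq> (v x - 1 > 0) \<longleftrightarrow> v x = 0"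
          using True by presburger
        then show ?thesis using x by auto
      qed simp
      also have "\<dots> = (if x = (i, e i) then mono_cochain (e(i := e i + 1)) v else 0)"
      proof (cases "x = (i, e i)")
        case x: True
        then have "P (e(i := e i + 1)) v \<longleftrightarrow> v x = 0" using main P by blast
        then show ?thesis
          unfolding if_P[OF x] mono using x by (intro arg_cong[of _ _ of_bool]) blast
      qed simp
      finally show ?thesis .
    qed
  qed
qed

lemma cobd_gen_mono:
  assumes v: "v \<in> cells" and i: "i \<in> {1..k}"
  shows "\<delta> (\<lambda>u. gen i u * mono_cochain e u) v = mono_cochain (e(i := e i + 1)) v"
proof (cases "e i \<le> d")
  case True
  then have "(i, e i) \<in> coords" using i by (simp add: coords_def)
  moreover have "\<delta> (\<lambda>u. gen i u * mono_cochain e u) v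
      = (\<Sum>x\<in>coords. if x = (i, e i) then mono_cochain (e(i := e i + 1)) v else 0)"
    unfolding cobd_def using coface_sum_gen_mono[where e = e, OF i True] by (intro sum.cong) auto
  ultimately show ?thesis by simp
next
  case False
  have "\<delta> (\<lambda>u. gen i u * mono_cochain e u) v = \<delta> (\<lambda>_. 0) v"
    using False i by (intro cobd_cong[OF v]) (simp add: mono_cochain_eq_0)
  also have "\<dots> = mono_cochain (e(i := e i + 1)) v"
    using False i v by (simp add: mono_cochain_eq_0 cobd_const)
  finally show ?thesis .
qed


definition rep :: "((nat \<Rightarrow> nat) \<Rightarrow>\<^sub>0 bit) \<Rightarrow> cell \<Rightarrow> bit" where
  "rep p v = (\<Sum>e\<in>Poly_Mapping.keys p. Poly_Mapping.lookup p e * mono_cochain e v)"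

lemma rep_superset:
  assumes "finite F" "Poly_Mapping.keys p \<subseteq> F"
  shows "rep p v = (\<Sum>e\<in>F. Poly_Mapping.lookup p e * mono_cochain e v)"
  unfolding rep_def using assms by (intro sum.mono_neutral_left) (auto simp: in_keys_iff)

lemma rep_add: "rep (p + q) v = rep p v + rep q v"
proof -
  let ?F = "Poly_Mapping.keys p \<union> Poly_Mapping.keys q"
  have "Poly_Mapping.keys (p + q) \<subseteq> ?F" by (rule Poly_Mapping.keys_add)
  then show ?thesis
    by (simp add: rep_superset[of ?F] lookup_add sum.distrib[symmetric] distrib_right)
qed

lemma rep_zero [simp]: "rep 0 v = 0"
  by (simp add: rep_def)

lemma rep_single [simp]: "rep (Poly_Mapping.single e c) v = c * mono_cochain e v"
  by (cases "c = 0") (simp_all add: rep_def)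

lemma rep_sum: "rep (\<Sum>x\<in>S. p x) v = (\<Sum>x\<in>S. rep (p x) v)"
  by (induction S rule: infinite_finite_induct) (simp_all add: rep_add)

lemma rep_single_times:
  "rep (Poly_Mapping.single f 1 * p) v = (\<Sum>e\<in>Poly_Mapping.keys p. Poly_Mapping.lookup p e * mono_cochain (f + e) v)"
proof -
  have "p = (\<Sum>e\<in>Poly_Mapping.keys p. Poly_Mapping.single e (Poly_Mapping.lookup p e))"
    by (rule poly_mapping_eqI) (simp add: lookup_sum lookup_single when_def in_keys_iff)
  then have "rep (Poly_Mapping.single f 1 * p) v
      = rep (\<Sum>e\<in>Poly_Mapping.keys p. Poly_Mapping.single f 1 * Poly_Mapping.single e (Poly_Mapping.lookup p e)) v"
    by (metis sum_distrib_left)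
  then show ?thesis
    by (simp add: rep_sum mult_single)
qed

text \<open>Multiplication by a variable becomes a cup product on the nose, not only up to a
  coboundary.\<close>

lemma rep_X_times:
  "v \<in> cells \<Longrightarrow> i \<in> {1..k} \<Longrightarrow> rep (X i * p) v = \<delta> (\<lambda>u. gen i u * rep p u) v"
proof -
  assume v: "v \<in> cells" and i: "i \<in> {1..k}"
  have "(\<lambda>l. of_bool (l = i)) + e = e(i := e i + 1)" for e :: "nat \<Rightarrow> nat"
    by (auto simp: fun_eq_iff)
  then have "rep (X i * p) v = (\<Sum>e\<in>Poly_Mapping.keys p. Poly_Mapping.lookup p e * mono_cochain (e(i := e i + 1)) v)"
    unfolding X_def rep_single_times by simp
  also have "\<dots> = (\<Sum>e\<in>Poly_Mapping.keys p. \<delta> (\<lambda>u. Poly_Mapping.lookup p e * (gen i u * mono_cochain e u)) v)"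
  proof (intro sum.cong refl)
    fix e assume "e \<in> Poly_Mapping.keys p"
    then have "Poly_Mapping.lookup p e = 1" by (simp add: in_keys_iff)
    then show "Poly_Mapping.lookup p e * mono_cochain (e(i := e i + 1)) v
        = \<delta> (\<lambda>u. Poly_Mapping.lookup p e * (gen i u * mono_cochain e u)) v"
      using cobd_gen_mono[OF v i] by simp
  qed
  also have "\<dots> = \<delta> (\<lambda>u. \<Sum>e\<in>Poly_Mapping.keys p. Poly_Mapping.lookup p e * (gen i u * mono_cochain e u)) v"
    by (rule cobd_sum[symmetric])
  also have "\<dots> = \<delta> (\<lambda>u. gen i u * rep p u) v"
    by (simp add: rep_def sum_distrib_left mult.left_commute)
  finally show ?thesis .
qed

text \<open>This is the relation \<open>X i ^ (d + 1) = 0\<close> in the cohomology of projective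
  space.\<close>

lemma rep_X_power_eq_0:
  assumes "v \<in> cells" "i \<in> {1..k}"
  shows "rep (q * X i ^ (d + 1)) v = 0"
proof -
  have "rep (q * X i ^ (d + 1)) v = rep (X i ^ (d + 1) * q) v"
    by (simp add: mult.commute)
  then show ?thesis
    unfolding X_power rep_single_times using assms by (simp add: mono_cochain_eq_0)
qed

text \<open>The support contains a single top cell: in each block the first \<open>d\<close>
  coordinates vanish, and the last one, being odd, must be \<open>M\<close>.\<close>

lemma sum_top_cells_mono_cochain:
  assumes "\<And>i. i \<in> {1..k} \<Longrightarrow> e i = d"
  shows "(\<Sum>v\<in>top_cells. mono_cochain e v) = 1"
proof -
  define w :: cell where "w = (\<lambda>x. if x \<in> coords \<and> snd x = d then M else 0)"
  have w: "w \<in> top_cells"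
    unfolding top_cells_def mem_Collect_eq
  proof (intro conjI ballI allI impI)
    fix i assume "i \<in> {1..k}"
    then show "\<exists>a\<le>d. w (i, a) = M \<and> (\<forall>b\<le>d. b \<noteq> a \<longrightarrow> even (w (i, b)) \<and> \<bar>w (i, b)\<bar> < M)"
      using M_pos by (intro exI[of _ d]) (auto simp: w_def coords_def)
  qed (simp add: w_def)
  have "mono_cochain e v = (if v = w then 1 else 0)" if v: "v \<in> top_cells" for v
  proof (cases "v = w")
    case True
    have "\<forall>i\<in>{1..k}. \<forall>a\<le>d. if a < e i then w (i, a) = 0 else odd (w (i, a))"
      using M_odd assms by (auto simp: w_def coords_def)
    then show ?thesis using True by (simp add: mono_cochain_def)
  next
    case False
    have "\<not> (\<forall>i\<in>{1..k}. \<forall>a\<le>d. if a < e i then v (i, a) = 0 else odd (v (i, a)))"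
    proof
      assume *: "\<forall>i\<in>{1..k}. \<forall>a\<le>d. if a < e i then v (i, a) = 0 else odd (v (i, a))"
      have "v x = w x" for x
      proof (cases "x \<in> coords")
        case True
        then obtain i a where x: "x = (i, a)" and i: "i \<in> {1..k}" and a: "a \<le> d"
          by (auto simp: coords_def)
        have od: "odd (v (i, d))" and z: "b < d \<Longrightarrow> v (i, b) = 0" for b
          using * i assms by force+
        have "pos v i = d"
          using pos(3)[OF v i, of d] od by (cases "d = pos v i") auto
        then have "v (i, d) = M"
          using pos(2)[OF v i] by simp
        then show ?thesis
          using z[of a] a True by (auto simp: x w_def)
      next
        case False
        then have "v x = 0" using v unfolding top_cells_def by blast
        then show ?thesis using False by (simp add: w_def)
      qed
      then show False using \<open>v \<noteq> w\<close> by blast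
    qed
    then show ?thesis using False by (simp add: mono_cochain_def)
  qed
  then have "(\<Sum>v\<in>top_cells. mono_cochain e v) = (\<Sum>v\<in>top_cells. if v = w then 1 else 0)"
    by (intro sum.cong) auto
  also have "\<dots> = 1" using w by simp
  finally show ?thesis .
qed

text \<open>Since \<open>cup \<epsilon> cs\<close> is a cocycle, the coboundary of its product with \<open>\<epsilon> c\<close> is its cup product with
  the coboundary of \<open>\<epsilon> c\<close>.\<close>

fun cup :: "('c \<Rightarrow> cell \<Rightarrow> bit) \<Rightarrow> 'c list \<Rightarrow> cell \<Rightarrow> bit" where
  "cup \<epsilon> [] = mono_cochain 0"
| "cup \<epsilon> (c # cs) = \<delta> (\<lambda>u. \<epsilon> c u * cup \<epsilon> cs u)"

text \<open>The unit \<open>mono_cochain 0\<close> sees only parities, which agree at both ends of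
  an interval; every longer product is itself a coboundary.\<close>

lemma cobd_cup: "\<delta> (cup \<epsilon> cs) v = 0"
proof (cases cs)
  case Nil
  have "coface_sum x (mono_cochain 0) v = 0" for x
  proof (cases "even (v x)")
    case True
    then have "odd ((v(x := v x + 1)) y) \<longleftrightarrow> odd ((v(x := v x - 1)) y)" for y
      by simp
    then have "mono_cochain 0 (v(x := v x + 1)) = mono_cochain 0 (v(x := v x - 1))"
      unfolding mono_cochain_def by simp
    then show ?thesis by (simp add: coface_sum_def)
  qed (simp add: coface_sum_def)
  then show ?thesis using Nil by (simp add: cobd_def)
qed (simp add: cobd_cobd)

lemma invariant_cup:
  assumes "\<And>c. c \<in> set cs \<Longrightarrow> equivariant (\<rho> c) (\<epsilon> c)"
  shows "invariant (cup \<epsilon> cs)"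
  using assms
proof (induction cs)
  case (Cons c cs)
  then show ?case
    using invariant_commutator[of "cup \<epsilon> cs" "\<rho> c" "\<epsilon> c"] by (simp add: cobd_cup)
next
  case Nil
  have "even (neg i v x) \<longleftrightarrow> even (v x)" for i v x
    by (simp add: neg_def)
  then show ?case by (simp add: invariant_def mono_cochain_def)
qed

text \<open>By \<open>cohomologous_cup\<close> each \<epsilon> may be exchanged for the sum of the
  standard cochains \<open>gen i\<close>, for which the cup product is multiplication by the linear
  form.\<close>

lemma cohomologous_cup_rep:
  assumes "\<And>c. c \<in> set cs \<Longrightarrow> equivariant (\<rho> c) (\<epsilon> c)"
    and "\<And>c. c \<in> set cs \<Longrightarrow> \<rho> c \<subseteq> {1..k}"
  shows "cohomologous (cup \<epsilon> cs) (rep (\<Prod>c\<leftarrow>cs. \<Sum>i\<in>\<rho> c. X i))"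
  using assms
proof (induction cs)
  case Nil
  have "invariant (\<lambda>_. 0)" by (simp add: invariant_def)
  moreover have "rep 1 v = mono_cochain 0 v" for v
    using rep_single[of 0 1 v] by simp
  ultimately show ?case
    by (auto simp: cohomologous_def cobd_const)
next
  case (Cons c cs)
  let ?p = "\<Prod>c\<leftarrow>cs. \<Sum>i\<in>\<rho> c. X i"
  let ?\<epsilon> = "\<lambda>u. \<Sum>i\<in>\<rho> c. gen i u"
  have \<rho>: "finite (\<rho> c)" "\<rho> c \<subseteq> {1..k}"
    using Cons.prems(2)[of c] by (auto intro: finite_subset)
  have "equivariant (\<rho> c) ?\<epsilon>" using \<rho>(2) by (rule equivariant_sum_gen)
  then have "cohomologous (cup \<epsilon> (c # cs)) (\<delta> (\<lambda>u. ?\<epsilon> u * rep ?p u))"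
    unfolding cup.simps using Cons
    by (intro cohomologous_cup[where A = "\<rho> c"] invariant_cup[where \<rho> = \<rho>]) auto
  moreover have "\<delta> (\<lambda>u. ?\<epsilon> u * rep ?p u) v = rep ((\<Sum>i\<in>\<rho> c. X i) * ?p) v" if v: "v \<in> cells" for v
  proof -
    have "rep ((\<Sum>i\<in>\<rho> c. X i) * ?p) v = (\<Sum>i\<in>\<rho> c. \<delta> (\<lambda>u. gen i u * rep ?p u) v)"
      unfolding sum_distrib_right rep_sum using \<rho> v by (intro sum.cong rep_X_times) auto
    then show ?thesis
      by (simp add: cobd_sum[symmetric] sum_distrib_right)
  qed
  ultimately show ?case
    by (simp add: cohomologous_def)
qed

text \<open>Where the cup product is nonzero, each factor changes its value along an edge of a flag of faces.\<close>

lemma cup_nonzero: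
  assumes "v \<in> cells" "cup \<epsilon> cs v \<noteq> 0" "c \<in> set cs"
  shows "\<exists>u\<in>cells. \<exists>w\<in>cells. \<epsilon> c u \<noteq> \<epsilon> c w \<and>
    (\<forall>x. \<bar>u x - v x\<bar> \<le> int (length cs) \<and> \<bar>w x - v x\<bar> \<le> int (length cs))"
  using assms
proof (induction cs arbitrary: v)
  case (Cons b cs)
  \<comment> \<open>Otherwise \<open>\<epsilon> b\<close> could be replaced by its value at
    \<open>v\<close> on every facet that matters and pulled out as a constant, leaving the
    coboundary of a cocycle, which is zero.\<close>
  have "\<exists>u\<in>cells. (\<forall>x. \<bar>u x - v x\<bar> \<le> 1) \<and> cup \<epsilon> cs u \<noteq> 0 \<and> \<epsilon> b u \<noteq> \<epsilon> b v"
  proof (rule ccontr)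
    assume *: "\<not> ?thesis"
    have face: "\<epsilon> b u * cup \<epsilon> cs u = \<epsilon> b v * cup \<epsilon> cs u"
      if "u \<in> cells" "\<And>x. \<bar>u x - v x\<bar> \<le> 1" for u
      using * that by (cases "cup \<epsilon> cs u = 0") auto
    have "cup \<epsilon> (b # cs) v = \<delta> (\<lambda>u. \<epsilon> b v * cup \<epsilon> cs u) v"
      unfolding cup.simps cobd_def coface_sum_def
    proof (intro sum.cong refl if_cong)
      fix x assume x: "x \<in> coords" "even (v x)"
      have "v(x := v x + 1) \<in> cells" "v(x := v x - 1) \<in> cells"
        using face_in_cells[OF Cons.prems(1) x, of 1] face_in_cells[OF Cons.prems(1) x, of "-1"] by auto
      then show "\<epsilon> b (v(x := v x + 1)) * cup \<epsilon> cs (v(x := v x + 1))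
            + \<epsilon> b (v(x := v x - 1)) * cup \<epsilon> cs (v(x := v x - 1))
          = \<epsilon> b v * cup \<epsilon> cs (v(x := v x + 1)) + \<epsilon> b v * cup \<epsilon> cs (v(x := v x - 1))"
        by (intro arg_cong2[of _ _ _ _ "(+)"] face) auto
    qed
    also have "\<dots> = 0"
      by (cases "\<epsilon> b v") (simp_all add: cobd_cup cobd_const)
    finally show False using Cons.prems(2) by simp
  qed
  then obtain u where u: "u \<in> cells" "\<And>x. \<bar>u x - v x\<bar> \<le> 1" "cup \<epsilon> cs u \<noteq> 0" "\<epsilon> b u \<noteq> \<epsilon> b v"
    by blast
  show ?case
  proof (cases "c = b")
    case True
    have "\<bar>u x - v x\<bar> \<le> int (length (b # cs))" for x
      using u(2)[of x] by simp
    then show ?thesis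
      using True u Cons.prems(1) by (intro bexI[of _ u] bexI[of _ v]) auto
  next
    case False
    then obtain r s where rs: "r \<in> cells" "s \<in> cells" "\<epsilon> c r \<noteq> \<epsilon> c s"
      and near: "\<And>x. \<bar>r x - u x\<bar> \<le> int (length cs) \<and> \<bar>s x - u x\<bar> \<le> int (length cs)"
      using Cons.IH[OF u(1) u(3)] Cons.prems(3) by auto
    have "\<bar>r x - v x\<bar> \<le> int (length (b # cs)) \<and> \<bar>s x - v x\<bar> \<le> int (length (b # cs))" for x
      using near[of x] u(2)[of x] unfolding length_Cons by linarith
    then show ?thesis using rs by blast
  qed
qed simp

text \<open>Summing the cup product over the top cells kills the invariant coboundary, the terms
  with \<open>X i ^ (d + 1)\<close> are represented by zero, and
  \<open>\<Prod>i=1..k. X i ^ d\<close> contributes 1. Hence the cup product is nonzero at some top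
  cell.\<close>

theorem combinatorial_zero:
  assumes "finite C" "\<And>c. c \<in> C \<Longrightarrow> equivariant (\<rho> c) (\<epsilon> c)" "\<And>c. c \<in> C \<Longrightarrow> \<rho> c \<subseteq> {1..k}"
    and "(\<Prod>c\<in>C. \<Sum>i\<in>\<rho> c. X i) = (\<Prod>i=1..k. X i ^ d) + (\<Sum>i=1..k. y i * X i ^ (d + 1))"
  shows "\<exists>v\<in>cells. \<forall>c\<in>C. \<exists>u\<in>cells. \<exists>w\<in>cells. \<epsilon> c u \<noteq> \<epsilon> c w \<and>
    (\<forall>x. \<bar>u x - v x\<bar> \<le> int (card C) \<and> \<bar>w x - v x\<bar> \<le> int (card C))"
proof -
  obtain cs where cs: "set cs = C" "distinct cs"
    using finite_distinct_list[OF assms(1)] by blast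
  have prod: "(\<Prod>c\<leftarrow>cs. \<Sum>i\<in>\<rho> c. X i) = (\<Prod>i=1..k. X i ^ d) + (\<Sum>i=1..k. y i * X i ^ (d + 1))"
    unfolding assms(4)[symmetric] using cs by (metis prod.distinct_set_conv_list)
  obtain \<beta> where \<beta>: "invariant \<beta>"
    "\<And>v. v \<in> cells \<Longrightarrow> cup \<epsilon> cs v = rep (\<Prod>c\<leftarrow>cs. \<Sum>i\<in>\<rho> c. X i) v + \<delta> \<beta> v"
    using cohomologous_cup_rep[of cs \<rho> \<epsilon>] assms cs by (auto simp: cohomologous_def)
  let ?e = "\<lambda>l. if l \<in> {1..k} then d else 0"
  have "rep (\<Prod>c\<leftarrow>cs. \<Sum>i\<in>\<rho> c. X i) v = mono_cochain ?e v" if v: "v \<in> cells" for v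
    unfolding prod rep_add rep_sum using rep_X_power_eq_0[OF v] by (simp add: prod_X_power)
  then have "(\<Sum>v\<in>top_cells. cup \<epsilon> cs v) = (\<Sum>v\<in>top_cells. mono_cochain ?e v + \<delta> \<beta> v)"
    using \<beta>(2) top_cells_subset by (intro sum.cong) auto
  also have "\<dots> = 1"
    using sum_top_cells_cobd[OF \<beta>(1)] sum_top_cells_mono_cochain[of ?e] by (simp add: sum.distrib)
  finally obtain v where v: "v \<in> top_cells" "cup \<epsilon> cs v \<noteq> 0"
    by (metis sum.neutral zero_neq_one)
  show ?thesis
    using cup_nonzero[of v \<epsilon> cs] v top_cells_subset cs distinct_card[OF cs(2)] by (metis subsetD)
qed

end

section \<open>Products of linear forms in characteristic two\<close>

text \<open>The identities are proved for arbitrary ring elements \<open>x a\<close> rather than for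
  variables, so that they apply again after substituting \<open>(x a)\<^sup>2 + x b * x a\<close>
  for \<open>x a\<close>.\<close>

locale char_two =
  fixes ty :: "'a::comm_ring_1 itself"
  assumes one_add_one_eq_0: "1 + 1 = (0::'a)"
begin

lemma add_self: "a + a = (0::'a)"
  by (metis distrib_left mult.right_neutral mult_zero_right one_add_one_eq_0)

lemma uminus_eq: "- a = (a::'a)"
  using add_self[of a] by (simp add: minus_unique)

lemma square_add: "(a + b)\<^sup>2 = a\<^sup>2 + (b::'a)\<^sup>2"
proof -
  have "(a + b)\<^sup>2 = a\<^sup>2 + b\<^sup>2 + (a * b + a * b)"
    by (simp add: power2_eq_square algebra_simps)
  then show ?thesis by (simp add: add_self)
qed

lemma frobenius_add: "(a + b) ^ 2 ^ n = a ^ 2 ^ n + (b::'a) ^ 2 ^ n"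
proof (induction n)
  case (Suc n)
  have "(a + b) ^ 2 ^ Suc n = ((a + b) ^ 2 ^ n)\<^sup>2"
    by (simp add: power_mult[symmetric] mult.commute)
  then show ?case
    by (simp add: Suc square_add power_mult[symmetric] mult.commute)
qed simp

lemma frobenius_sum: "(\<Sum>i\<in>S. f i) ^ 2 ^ n = (\<Sum>i\<in>S. f i ^ 2 ^ n :: 'a)"
  by (induction S rule: infinite_finite_induct) (simp_all add: frobenius_add power_0_left)

section \<open>Dickson products: all nonzero linear forms over the field with two elements\<close>

definition dickson :: "('b \<Rightarrow> 'a) \<Rightarrow> 'b set \<Rightarrow> 'a" where
  "dickson x S = (\<Prod>A\<in>Pow S - {{}}. \<Sum>a\<in>A. x a)"

lemma dickson_empty [simp]: "dickson x {} = 1"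
  by (simp add: dickson_def)

lemma dickson_singleton: "dickson x {a} = x a"
proof -
  have "Pow {a} - {{}} = {{a}}" by auto
  then show ?thesis by (simp add: dickson_def)
qed

lemma Pow_insert_nonempty: "Pow (insert b S) - {{}} = (Pow S - {{}}) \<union> insert b ` Pow S"
  by (auto simp: Pow_insert)

lemma dickson_insert:
  assumes "finite S" "b \<notin> S"
  shows "dickson x (insert b S) = dickson x S * (\<Prod>A\<in>Pow S. x b + (\<Sum>a\<in>A. x a))"
proof -
  have "inj_on (insert b) (Pow S)"
    using assms(2) by (intro inj_onI) (metis PowD insert_ident subsetD)
  moreover have "(Pow S - {{}}) \<inter> insert b ` Pow S = {}"
    using assms(2) by auto
  moreover have "(\<Sum>a\<in>insert b A. x a) = x b + (\<Sum>a\<in>A. x a)" if "A \<in> Pow S" for A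
    using that assms by (subst sum.insert) (auto intro: finite_subset)
  ultimately show ?thesis
    unfolding dickson_def Pow_insert_nonempty using assms(1)
    by (simp add: prod.union_disjoint prod.reindex)
qed

lemma prod_Pow:
  assumes "finite S"
  shows "(\<Prod>A\<in>Pow S. f A) = f {} * (\<Prod>A\<in>Pow S - {{}}. f A :: 'a)"
  using assms by (subst prod.remove[of _ "{}"]) auto

text \<open>Squaring is additive, so the substituted form attached to \<open>A\<close> factors as
  \<open>L * (x b + L)\<close> with \<open>L = (\<Sum>a\<in>A. x a)\<close>: the forms without and
  with \<open>b\<close> are paired.\<close>

lemma dickson_insert_substitute:
  assumes "finite S" "b \<notin> S"
  shows "dickson x (insert b S) = x b * dickson (\<lambda>a. (x a)\<^sup>2 + x b * x a) S"
proof -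
  have "(\<Sum>a\<in>A. (x a)\<^sup>2 + x b * x a) = (\<Sum>a\<in>A. x a) * (x b + (\<Sum>a\<in>A. x a))" for A
  proof -
    have "(\<Sum>a\<in>A. (x a)\<^sup>2 + x b * x a) = (\<Sum>a\<in>A. x a)\<^sup>2 + x b * (\<Sum>a\<in>A. x a)"
      using frobenius_sum[of x A 1] by (simp add: sum.distrib sum_distrib_left)
    then show ?thesis by (simp add: power2_eq_square algebra_simps)
  qed
  then have "dickson (\<lambda>a. (x a)\<^sup>2 + x b * x a) S
      = dickson x S * (\<Prod>A\<in>Pow S - {{}}. x b + (\<Sum>a\<in>A. x a))"
    unfolding dickson_def prod.distrib[symmetric] by (intro prod.cong refl)
  then show ?thesis
    unfolding dickson_insert[OF assms] prod_Pow[OF assms(1)] by (simp add: mult_ac)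
qed

lemma dvd_dickson:
  assumes "finite S" "a \<in> S"
  shows "x a dvd dickson x S"
proof -
  have "{a} \<in> Pow S - {{}}" using assms by auto
  then have "(\<Sum>c\<in>{a}. x c) dvd dickson x S"
    unfolding dickson_def using assms(1) by (intro dvd_prodI) auto
  then show ?thesis by simp
qed

lemma prod_add_mod: "finite F \<Longrightarrow> \<exists>z. (\<Prod>A\<in>F. y + f A) = (\<Prod>A\<in>F. f A) + y * (z::'a)"
proof (induction F rule: finite_induct)
  case empty
  show ?case by (intro exI[of _ 0]) simp
next
  case (insert A F)
  then obtain z where "(\<Prod>A\<in>F. y + f A) = (\<Prod>A\<in>F. f A) + y * z" by auto
  then show ?case
    using insert by (intro exI[of _ "(\<Prod>A\<in>F. f A) + y * z + f A * z"]) (simp add: algebra_simps)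
qed

text \<open>Modulo \<open>x b\<close> each form \<open>x b + L\<close> reduces to \<open>L\<close>,
  so the nonempty subsets yield a second copy of \<open>dickson x S\<close>; the empty one yields
  the factor \<open>x b\<close>.\<close>

lemma dickson_insert_low:
  assumes "finite S" "b \<notin> S"
  obtains z where "dickson x (insert b S) = x b * ((dickson x S)\<^sup>2 + x b * z)"
proof -
  obtain z where "(\<Prod>A\<in>Pow S - {{}}. x b + (\<Sum>a\<in>A. x a)) = dickson x S + x b * z"
    unfolding dickson_def using prod_add_mod[of "Pow S - {{}}" "x b" "sum x"] assms(1) by auto
  then have "dickson x (insert b S) = x b * ((dickson x S)\<^sup>2 + x b * (dickson x S * z))"
    by (simp add: dickson_insert[OF assms] prod_Pow[OF assms(1)] power2_eq_square algebra_simps)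
  then show ?thesis by (rule that)
qed

section \<open>The Moore determinant\<close>

definition moore :: "('b \<Rightarrow> 'a) \<Rightarrow> 'b list \<Rightarrow> 'a mat" where
  "moore x l = mat (length l) (length l) (\<lambda>(i, s). x (l ! i) ^ 2 ^ s)"

text \<open>Adding to each column a multiple of the preceding one replaces \<open>x a\<close> by
  \<open>(x a)\<^sup>2 + x b * x a\<close>, as in the evaluation of the Vandermonde determinant.\<close>

lemma det_moore_Cons:
  "det (moore x (b # l)) = x b * det (moore (\<lambda>a. (x a)\<^sup>2 + x b * x a) l)"
proof -
  define n where "n = length l"
  define A where "A = moore x (b # l)"
  \<comment> \<open>Right multiplication by \<open>U\<close> adds \<open>x b ^ 2 ^ r\<close> times
    column \<open>r\<close> to column \<open>r + 1\<close>; by Frobenius each new entry is a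
    \<open>2 ^ r\<close>-th power.\<close>
  define U :: "'a mat" where
    "U = mat (Suc n) (Suc n) (\<lambda>(r, s). if r = s then 1 else if Suc r = s then x b ^ 2 ^ r else 0)"
  have A: "A \<in> carrier_mat (Suc n) (Suc n)" and U: "U \<in> carrier_mat (Suc n) (Suc n)"
    by (simp_all add: A_def U_def moore_def n_def)
  have "det U = prod_list (diag_mat U)"
    using U by (intro det_upper_triangular) (auto simp: U_def)
  also have "diag_mat U = replicate (Suc n) 1"
    by (rule nth_equalityI) (auto simp: diag_mat_def U_def simp del: upt_Suc replicate_Suc)
  finally have "det U = 1" by simp
  then have "det A = det (A * U)"
    by (simp add: det_mult[OF A U])
  also have "A * U = mat (Suc n) (Suc n) (\<lambda>(i, s). case s of 0 \<Rightarrow> x ((b # l) ! i)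
      | Suc s \<Rightarrow> ((x ((b # l) ! i))\<^sup>2 + x b * x ((b # l) ! i)) ^ 2 ^ s)" (is "_ = ?B")
  proof (rule eq_matI)
    fix i s assume "i < dim_row ?B" "s < dim_col ?B"
    then have i: "i < Suc n" and s: "s < Suc n" by auto
    let ?c = "x ((b # l) ! i)"
    have "(A * U) $$ (i, s) = (\<Sum>r\<in>{0..<Suc n}. A $$ (i, r) * U $$ (r, s))"
      using A U i s by (simp add: scalar_prod_def)
    also have "\<dots> = (\<Sum>r\<in>{0..<Suc n}. (if r = s then ?c ^ 2 ^ s else 0)
        + (if Suc r = s then ?c ^ 2 ^ r * x b ^ 2 ^ r else 0))"
      using i s by (intro sum.cong) (auto simp: A_def U_def moore_def n_def)
    also have "\<dots> = ?c ^ 2 ^ s + (\<Sum>r\<in>{0..<Suc n}. if Suc r = s then ?c ^ 2 ^ r * x b ^ 2 ^ r else 0)"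
      using s by (simp add: sum.distrib)
    also have "\<dots> = (case s of 0 \<Rightarrow> ?c | Suc s \<Rightarrow> (?c\<^sup>2 + x b * ?c) ^ 2 ^ s)"
      using s by (cases s) (auto simp: frobenius_add power_mult_distrib power_mult[symmetric] mult.commute)
    finally show "(A * U) $$ (i, s) = ?B $$ (i, s)"
      using i s by simp
  qed (use A U in auto)
  also have "det ?B = (\<Sum>s<Suc n. ?B $$ (0, s) * cofactor ?B 0 s)"
    by (rule laplace_expansion_row) auto
  \<comment> \<open>In the row of \<open>b\<close> the substituted element is
    \<open>(x b)\<^sup>2 + x b * x b\<close>, which is zero, so only column 0 survives.\<close>
  also have "\<dots> = (\<Sum>s<Suc n. if s = 0 then x b * cofactor ?B 0 0 else 0)"
    by (intro sum.cong) (auto split: nat.splits simp: power2_eq_square add_self power_0_left)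
  also have "\<dots> = x b * det (mat_delete ?B 0 0)"
    by (simp add: cofactor_def del: sum.lessThan_Suc)
  also have "mat_delete ?B 0 0 = moore (\<lambda>a. (x a)\<^sup>2 + x b * x a) l"
    by (rule eq_matI) (auto simp: mat_delete_def moore_def n_def)
  finally show ?thesis by (simp add: A_def)
qed

lemma det_moore: "distinct l \<Longrightarrow> det (moore x l) = dickson x (set l)"
proof (induction l arbitrary: x)
  case Nil
  show ?case by (simp add: moore_def det_dim_zero)
next
  case (Cons b l)
  then show ?case by (simp add: det_moore_Cons dickson_insert_substitute)
qed

text \<open>This is the expansion of the Moore determinant along its last column, which holds the
  highest Frobenius powers; the cofactor in the row of \<open>b\<close> is the Moore determinant of
  \<open>S\<close>, and its sign disappears in characteristic two.\<close>

lemma dickson_insert_high: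
  assumes "finite S" "b \<notin> S"
  obtains z where "dickson x (insert b S)
    = x b ^ 2 ^ card S * dickson x S + (\<Sum>a\<in>S. x a ^ 2 ^ card S * z a)"
proof -
  obtain l where l: "set l = S" "distinct l"
    using finite_distinct_list[OF assms(1)] by blast
  define n where "n = length l"
  have n: "n = card S" using distinct_card[OF l(2)] l(1) by (simp add: n_def)
  define A where "A = moore x (b # l)"
  define g where "g i = cofactor A (Suc i) n" for i
  have "dickson x (insert b S) = det A"
    using det_moore[of "b # l" x] l assms(2) by (simp add: A_def)
  also have "\<dots> = (\<Sum>i<Suc n. A $$ (i, n) * cofactor A i n)"
    by (rule laplace_expansion_column) (auto simp: A_def n_def moore_def)
  also have "\<dots> = A $$ (0, n) * cofactor A 0 n + (\<Sum>i<n. A $$ (Suc i, n) * g i)"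
    unfolding g_def by (subst sum.lessThan_Suc_shift) simp
  also have "A $$ (0, n) = x b ^ 2 ^ card S"
    by (simp add: A_def moore_def n_def n[symmetric])
  also have "cofactor A 0 n = dickson x S"
  proof -
    have "mat_delete A 0 n = moore x l"
      by (rule eq_matI) (auto simp: mat_delete_def moore_def A_def n_def)
    then show ?thesis
      using det_moore[OF l(2), of x] l(1) by (simp add: cofactor_def uminus_eq)
  qed
  also have "(\<Sum>i<n. A $$ (Suc i, n) * g i)
      = (\<Sum>i<n. x (l ! i) ^ 2 ^ card S * g (the_inv_into {..<n} ((!) l) (l ! i)))"
  proof (intro sum.cong refl)
    fix i assume i: "i \<in> {..<n}"
    have "inj_on ((!) l) {..<n}"
      using l(2) by (simp add: n_def inj_on_nth)
    then show "A $$ (Suc i, n) * g i = x (l ! i) ^ 2 ^ card S * g (the_inv_into {..<n} ((!) l) (l ! i))"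
      using i by (simp add: the_inv_into_f_f A_def moore_def n_def n[symmetric])
  qed
  also have "\<dots> = (\<Sum>a\<in>S. x a ^ 2 ^ card S * g (the_inv_into {..<n} ((!) l) a))"
    using bij_betw_nth[OF l(2), of "{..<n}" S] l(1)
    by (intro sum.reindex_bij_betw) (simp_all add: n_def)
  finally show ?thesis by (rule that)
qed

section \<open>Elimination in the cohomology ring of a product of projective spaces\<close>

definition trunc_ideal :: "(nat \<Rightarrow> 'a) \<Rightarrow> nat \<Rightarrow> nat \<Rightarrow> 'a set" where
  "trunc_ideal x k d = {a. \<exists>y. a = (\<Sum>i=1..k. y i * x i ^ (d + 1))}"

lemma trunc_idealI: "a = (\<Sum>i=1..k. y i * x i ^ (d + 1)) \<Longrightarrow> a \<in> trunc_ideal x k d"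
  unfolding trunc_ideal_def by blast

lemma trunc_ideal_zero: "0 \<in> trunc_ideal x k d"
  unfolding trunc_ideal_def by (auto intro!: exI[of _ "\<lambda>_. 0"])

lemma trunc_ideal_add:
  assumes "a \<in> trunc_ideal x k d" "b \<in> trunc_ideal x k d"
  shows "a + b \<in> trunc_ideal x k d"
proof -
  obtain y z where "a = (\<Sum>i=1..k. y i * x i ^ (d + 1))" "b = (\<Sum>i=1..k. z i * x i ^ (d + 1))"
    using assms unfolding trunc_ideal_def by auto
  then have "a + b = (\<Sum>i=1..k. (y i + z i) * x i ^ (d + 1))"
    by (simp add: sum.distrib distrib_right)
  then show ?thesis by (rule trunc_idealI)
qed

lemma trunc_ideal_mult:
  assumes "a \<in> trunc_ideal x k d"
  shows "c * a \<in> trunc_ideal x k d"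
proof -
  obtain y where "a = (\<Sum>i=1..k. y i * x i ^ (d + 1))"
    using assms unfolding trunc_ideal_def by auto
  then have "c * a = (\<Sum>i=1..k. (c * y i) * x i ^ (d + 1))"
    by (simp add: sum_distrib_left mult.assoc)
  then show ?thesis by (rule trunc_idealI)
qed

lemma trunc_ideal_dvd:
  assumes "x i ^ (d + 1) dvd a" "i \<in> {1..k}"
  shows "a \<in> trunc_ideal x k d"
proof -
  obtain c where c: "a = x i ^ (d + 1) * c" using assms(1) by (rule dvdE)
  have "(\<Sum>l=1..k. (if l = i then c else 0) * x l ^ (d + 1)) = (\<Sum>l=1..k. if l = i then c * x i ^ (d + 1) else 0)"
    by (intro sum.cong) auto
  also have "\<dots> = a" using assms(2) c by (simp add: mult.commute)
  finally have "a = (\<Sum>l=1..k. (if l = i then c else 0) * x l ^ (d + 1))" ..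
  then show ?thesis by (rule trunc_idealI)
qed

lemma trunc_ideal_sum:
  "(\<And>a. a \<in> S \<Longrightarrow> f a \<in> trunc_ideal x k d) \<Longrightarrow> sum f S \<in> trunc_ideal x k d"
  by (induction S rule: infinite_finite_induct) (simp_all add: trunc_ideal_zero trunc_ideal_add)

text \<open>Only \<open>x l\<close> can carry the exponent \<open>2 ^ (q + k - 1)\<close> in the power of the Dickson product,
  because the cofactor already contains every later variable to a power exceeding \<open>r\<close>.\<close>

lemma eliminate_variable:
  fixes x :: "nat \<Rightarrow> 'a"
  assumes l: "1 \<le> l" "l < k" and d: "d = 2 ^ (q + k - 1) + r"
    and G: "G = G' + x l * G''" and dvd: "\<And>a. a \<in> {l+1..k} \<Longrightarrow> x a dvd G"
  shows "dickson x {l..k} ^ (2 ^ (q + l - 1) + r) * G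
       + x l ^ d * (dickson x {l+1..k} ^ (2 ^ (q + l - 1) + 2 * r) * G') \<in> trunc_ideal x k d"
proof -
  let ?S = "{l+1..k}" and ?E = "2 ^ (q + l - 1) :: nat"
  define w where "w = dickson x {l..k}"
  define w' where "w' = dickson x ?S"
  have ins: "{l..k} = insert l ?S" using l by auto
  have S: "finite ?S" "l \<notin> ?S" "card ?S = k - l" by auto
  have exp: "2 ^ (k - l) * ?E = 2 ^ (q + k - 1)"
    using l by (simp add: power_add[symmetric])
  obtain z where "w = x l ^ 2 ^ (k - l) * w' + (\<Sum>a\<in>?S. x a ^ 2 ^ (k - l) * z a)"
    using dickson_insert_high[OF S(1,2), of x] S(3) unfolding w_def w'_def ins by metis
  \<comment> \<open>The exponent \<open>?E\<close> is a power of two, so Frobenius distributes it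
    over the expansion with the high powers.\<close>
  then have wE: "w ^ ?E = x l ^ 2 ^ (q + k - 1) * w' ^ ?E + (\<Sum>a\<in>?S. x a ^ 2 ^ (q + k - 1) * z a ^ ?E)"
    by (simp only: frobenius_add frobenius_sum power_mult_distrib power_mult[symmetric] exp)
  \<comment> \<open>The remaining \<open>r\<close> factors are expanded from the low end: together
    they give \<open>x l ^ r * w' ^ (2 * r)\<close> up to higher powers of
    \<open>x l\<close>.\<close>
  obtain y where y: "w = x l * (w'\<^sup>2 + x l * y)"
    using dickson_insert_low[OF S(1,2), of x] unfolding w_def w'_def ins by metis
  have "\<exists>y'. (w'\<^sup>2 + x l * y) ^ r = w' ^ (2 * r) + x l * y'"
  proof -
    have "\<exists>y'. (\<Prod>i\<in>{..<r}. x l * y + w'\<^sup>2) = (\<Prod>i\<in>{..<r}. w'\<^sup>2) + (x l * y) * y'"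
      by (rule prod_add_mod) simp
    then show ?thesis by (auto simp: power_mult add.commute mult.assoc)
  qed
  then obtain y' where y': "(w'\<^sup>2 + x l * y) ^ r = w' ^ (2 * r) + x l * y'" by blast
  have wr: "w ^ r = x l ^ r * (w' ^ (2 * r) + x l * y')"
    unfolding y power_mult_distrib y' ..
  have "w ^ (?E + r) * G = (\<Sum>a\<in>?S. x a ^ 2 ^ (q + k - 1) * z a ^ ?E * (w ^ r * G))
      + x l ^ 2 ^ (q + k - 1) * w' ^ ?E * (w ^ r * G)"
    unfolding power_add[of w] wE sum_distrib_right[symmetric] by (simp only: distrib_left distrib_right mult_ac add_ac)
  also have "x l ^ 2 ^ (q + k - 1) * w' ^ ?E * (w ^ r * G)
      = x l ^ d * (w' ^ (?E + 2 * r) * G')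
      + x l ^ (d + 1) * (w' ^ ?E * (w' ^ (2 * r) * G'' + y' * G' + x l * y' * G''))"
    unfolding wr G d by (simp add: power_add algebra_simps)
  finally have "w ^ (?E + r) * G + x l ^ d * (w' ^ (?E + 2 * r) * G')
      = (\<Sum>a\<in>?S. x a ^ 2 ^ (q + k - 1) * z a ^ ?E * (w ^ r * G))
      + x l ^ (d + 1) * (w' ^ ?E * (w' ^ (2 * r) * G'' + y' * G' + x l * y' * G''))
      + (x l ^ d * (w' ^ (?E + 2 * r) * G') + x l ^ d * (w' ^ (?E + 2 * r) * G'))"
    by (simp only: add_ac)
  also have "\<dots> = (\<Sum>a\<in>?S. x a ^ 2 ^ (q + k - 1) * z a ^ ?E * (w ^ r * G))
      + x l ^ (d + 1) * (w' ^ ?E * (w' ^ (2 * r) * G'' + y' * G' + x l * y' * G''))"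
    by (simp only: add_self add_0_right)
  also have "\<dots> \<in> trunc_ideal x k d"
  proof (intro trunc_ideal_add trunc_ideal_sum)
    fix a assume a: "a \<in> ?S"
    then have "x a dvd w" unfolding w_def by (intro dvd_dickson) auto
    then have "x a ^ r * x a dvd w ^ r * G"
      using mult_dvd_mono[OF dvd_power_same dvd[OF a]] by blast
    then have "x a ^ 2 ^ (q + k - 1) * (x a ^ r * x a) dvd x a ^ 2 ^ (q + k - 1) * (w ^ r * G)"
      by (rule mult_dvd_mono[OF dvd_refl])
    then have "x a ^ (d + 1) dvd x a ^ 2 ^ (q + k - 1) * (w ^ r * G)"
      unfolding d by (simp add: power_add mult_ac)
    then have "x a ^ (d + 1) dvd z a ^ ?E * (x a ^ 2 ^ (q + k - 1) * (w ^ r * G))"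
      by (rule dvd_mult)
    then show "x a ^ 2 ^ (q + k - 1) * z a ^ ?E * (w ^ r * G) \<in> trunc_ideal x k d"
      using a by (intro trunc_ideal_dvd[where i = a]) (auto simp: mult_ac)
    next
    show "x l ^ (d + 1) * (w' ^ ?E * (w' ^ (2 * r) * G'' + y' * G' + x l * y' * G'')) \<in> trunc_ideal x k d"
      using l by (intro trunc_ideal_dvd[where i = l]) (rule dvd_triv_left, simp)
  qed
  finally show ?thesis
    unfolding w_def w'_def .
qed

text \<open>The variables are eliminated in increasing order. The numbers \<open>m i\<close> are
  tuned so that each step reproduces its own shape: removing \<open>x l\<close> leaves
  \<open>dickson x {l+1..k}\<close> to the power \<open>2 ^ (q + l - 1) + 2 * r\<close>, and
  \<open>m (l + 1)\<close> raises this to \<open>2 ^ (q + l) + r\<close>.\<close>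

lemma prod_dickson:
  fixes x :: "nat \<Rightarrow> 'a"
  assumes t: "1 \<le> t" "t \<le> 2 ^ q" and k: "k \<ge> 3" and R: "R \<subseteq> {1..<k}"
    and j: "card R = j" "1 \<le> j"
    and m1: "m 1 = 2 ^ (q + 1) - t"
    and m: "\<And>i. i \<in> {2..k - 1} \<Longrightarrow> m i = 2 ^ q * (2 ^ (i - 2) - 1) + t"
    and mk: "m k = 2 ^ q * (2 ^ (k - 2) - 1) + t - j" "j \<le> 2 ^ q * (2 ^ (k - 2) - 1) + t"
    and d: "d = 2 ^ (q + k - 1) + (2 ^ q - t)"
  shows "(\<Prod>i=1..k. dickson x {i..k} ^ m i) * (\<Prod>s\<in>R. x s + x k) + (\<Prod>i=1..k. x i ^ d)
      \<in> trunc_ideal x k d"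
proof -
  define r where "r = 2 ^ q - t"
  \<comment> \<open>\<open>G l\<close> is the cofactor of the \<open>l\<close>-th Dickson power once
    the variables before \<open>l\<close> are gone: the orthogonality factors
    \<open>x s + x k\<close> with \<open>s < l\<close> have become \<open>x k\<close>.
    \<open>G' l\<close> also sets \<open>x l\<close> to zero in its own orthogonality
    factor.\<close>
  define G where "G l = (\<Prod>i\<in>{l+1..<k}. dickson x {i..k} ^ m i) * x k ^ (m k + card {s \<in> R. s < l})
    * (\<Prod>s\<in>{s \<in> R. l \<le> s}. x s + x k)" for l
  define G' where "G' l = (\<Prod>i\<in>{l+1..<k}. dickson x {i..k} ^ m i) * x k ^ (m k + card {s \<in> R. s < l + 1})
    * (\<Prod>s\<in>{s \<in> R. l + 1 \<le> s}. x s + x k)" for l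
  define Q where "Q = (\<Prod>i=1..k. dickson x {i..k} ^ m i) * (\<Prod>s\<in>R. x s + x k)"
  define D where "D l = dickson x {l..k}" for l
  have finR: "finite R" using R finite_subset by blast
  have tr: "2 ^ q = t + r" using t by (simp add: r_def)
  have exponent: "2 ^ (q + l - 1) + 2 * r + (2 ^ q * (2 ^ (l + 1 - 2) - 1) + t) = 2 ^ (q + l) + r"
    if l1: "1 \<le> l" for l
  proof -
    obtain n where n: "l = Suc n" using l1 by (cases l) auto
    have "(2::nat) ^ n \<ge> 1" by simp
    then obtain c where c: "(2::nat) ^ n = Suc c" by (metis Suc_le_D One_nat_def)
    show ?thesis unfolding n by (simp add: power_add c tr algebra_simps)
  qed
  have Dk: "D k = x k" by (simp add: D_def dickson_singleton)
  have split: "\<exists>G''. G l = G' l + x l * G''" if l: "1 \<le> l" "l < k" for l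
  proof (cases "l \<in> R")
    case True
    have "{s \<in> R. s < l + 1} = insert l {s \<in> R. s < l}" and 2: "{s \<in> R. l \<le> s} = insert l {s \<in> R. l + 1 \<le> s}"
      using True by auto
    then have 1: "card {s \<in> R. s < l + 1} = Suc (card {s \<in> R. s < l})"
      using finR by simp
    let ?P = "(\<Prod>i\<in>{l+1..<k}. dickson x {i..k} ^ m i) * x k ^ (m k + card {s \<in> R. s < l})
      * (\<Prod>s\<in>{s \<in> R. l + 1 \<le> s}. x s + x k)"
    have "G l = G' l + x l * ?P"
      unfolding G_def G'_def 1 2 using finR by (simp add: algebra_simps)
    then show ?thesis by blast
  next
    case False
    then have "{s \<in> R. s < l + 1} = {s \<in> R. s < l}" "{s \<in> R. l \<le> s} = {s \<in> R. l + 1 \<le> s}"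
      by (auto simp: less_Suc_eq Suc_le_eq le_less)
    then have "G l = G' l + x l * 0" by (simp add: G_def G'_def)
    then show ?thesis by blast
  qed
  have dvd: "x a dvd G l" if l: "1 \<le> l" "l < k" and a: "a \<in> {l+1..k}" for l a
  proof (cases "l + 1 < k")
    case True
    have "l + 1 \<in> {2..k - 1}" using True l by auto
    then have "m (l + 1) > 0" using m[of "l + 1"] t by simp
    then have "D (l + 1) dvd D (l + 1) ^ m (l + 1)" by (intro dvd_power) simp
    moreover have "D (l + 1) ^ m (l + 1) dvd (\<Prod>i\<in>{l+1..<k}. dickson x {i..k} ^ m i)"
      unfolding D_def using True by (intro dvd_prodI[where f = "\<lambda>i. dickson x {i..k} ^ m i"]) auto
    moreover have "x a dvd D (l + 1)"
      unfolding D_def using a by (intro dvd_dickson) auto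
    ultimately have "x a dvd (\<Prod>i\<in>{l+1..<k}. dickson x {i..k} ^ m i)"
      by (meson dvd_trans)
    then show ?thesis unfolding G_def by (intro dvd_mult2)
  next
    case False
    then have lk: "l = k - 1" "a = k" using l a by auto
    \<comment> \<open>Here \<open>m k\<close> may be zero, but then some \<open>s \<in> R\<close>
      below \<open>k - 1\<close> has already left a factor \<open>x k\<close>; if there is no such
      \<open>s\<close>, then \<open>j \<le> 1\<close> and \<open>m k\<close> is positive.\<close>
    have "m k + card {s \<in> R. s < l} > 0"
    proof (cases "{s \<in> R. s < l} = {}")
      case True
      then have "R \<subseteq> {k - 1}" using R lk by fastforce
      then have "j \<le> 1" using j(1) card_mono[of "{k - 1}" R] by simp
      moreover have "(2::nat) ^ (k - 2) \<ge> 2" using k power_increasing[of 1 "k - 2" "2::nat"] by simp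
      then have "2 ^ q * (2 ^ (k - 2) - 1) \<ge> (1::nat)" by simp
      ultimately have "m k > 0" using mk(1) t by linarith
      then show ?thesis by simp
    next
      case False
      then show ?thesis using finR by (simp add: card_gt_0_iff)
    qed
    then have "x a dvd x k ^ (m k + card {s \<in> R. s < l})"
      unfolding lk(2) by (intro dvd_power) auto
    then show ?thesis unfolding G_def by (rule dvd_mult2[OF dvd_mult])
  qed
  have elim: "D l ^ (2 ^ (q + l - 1) + r) * G l + x l ^ d * (D (l + 1) ^ (2 ^ (q + l - 1) + 2 * r) * G' l)
      \<in> trunc_ideal x k d" if l: "1 \<le> l" "l < k" for l
  proof -
    obtain G'' where "G l = G' l + x l * G''" using split[OF l] by blast
    then show ?thesis
      unfolding D_def using d dvd[OF l] by (intro eliminate_variable[OF l]) (auto simp: r_def)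
  qed
  \<comment> \<open>Invariant of the elimination; in characteristic two, membership of the sum in
    the ideal is congruence of the summands.\<close>
  have chain: "Q + (\<Prod>i\<in>{1..<l}. x i ^ d) * (D l ^ (2 ^ (q + l - 1) + r) * G l) \<in> trunc_ideal x k d"
    if "1 \<le> l" "l < k" for l
    using that
  proof (induction l rule: dec_induct)
    case base
    have "{1..k} = insert 1 (insert k {2..<k})" using k by auto
    then have "(\<Prod>i=1..k. D i ^ m i) = D 1 ^ m 1 * ((\<Prod>i\<in>{2..<k}. D i ^ m i) * x k ^ m k)"
      using k by (simp add: Dk mult_ac)
    moreover have G1: "G 1 = (\<Prod>i\<in>{2..<k}. D i ^ m i) * x k ^ m k * (\<Prod>s\<in>R. x s + x k)"
    proof -
      have 1: "{s \<in> R. s < 1} = {}" and 2: "{s \<in> R. 1 \<le> s} = R" using R by auto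
      show ?thesis unfolding G_def 1 2 D_def by (simp add: numeral_2_eq_2)
    qed
    moreover have "m 1 = 2 ^ q + r" using m1 t by (simp add: tr)
    ultimately have "Q = D 1 ^ (2 ^ (q + 1 - 1) + r) * G 1"
      unfolding Q_def G1 by (simp add: D_def mult.assoc)
    then show ?case by (simp add: add_self trunc_ideal_zero)
  next
    case (step l)
    let ?p = "\<Prod>i\<in>{1..<l}. x i ^ d"
    let ?A = "D l ^ (2 ^ (q + l - 1) + r) * G l"
    let ?B = "D (l + 1) ^ (2 ^ (q + l - 1) + 2 * r) * G' l"
    have l: "1 \<le> l" "l < k" "l + 1 < k" using step by auto
    have "(\<Prod>i\<in>{l+1..<k}. D i ^ m i) = D (l + 1) ^ m (l + 1) * (\<Prod>i\<in>{l+2..<k}. D i ^ m i)"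
      using l(3) by (simp add: prod.atLeast_Suc_lessThan)
    then have "?B = D (l + 1) ^ (2 ^ (q + l - 1) + 2 * r + m (l + 1)) * G (l + 1)"
      unfolding G_def G'_def D_def by (simp add: power_add mult_ac)
    also have "2 ^ (q + l - 1) + 2 * r + m (l + 1) = 2 ^ (q + l) + r"
      using m[of "l + 1"] exponent[OF l(1)] l by simp
    finally have B: "?B = D (l + 1) ^ (2 ^ (q + l) + r) * G (l + 1)" .
    have "Q + ?p * ?A + ?p * (?A + x l ^ d * ?B) \<in> trunc_ideal x k d"
      using trunc_ideal_add[OF step.IH[OF l(2)] trunc_ideal_mult[OF elim[OF l(1,2)]]] .
    also have "Q + ?p * ?A + ?p * (?A + x l ^ d * ?B) = Q + (?p * ?A + ?p * ?A) + ?p * x l ^ d * ?B"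
      by (simp only: distrib_left add.assoc mult.assoc)
    also have "\<dots> = Q + (\<Prod>i\<in>{1..<l+1}. x i ^ d) * ?B"
      using l(1) by (simp add: add_self prod.atLeastLessThan_Suc)
    finally show ?case unfolding B by simp
  qed
  \<comment> \<open>The last elimination is separate: the Dickson product that remains is
    \<open>x k\<close> itself, and the \<open>j\<close> factors from the orthogonality conditions
    restore the exponent missing in \<open>m k\<close>.\<close>
  define l where "l = k - 1"
  have l: "1 \<le> l" "l < k" "l + 1 = k" using k by (auto simp: l_def)
  let ?p = "\<Prod>i\<in>{1..<l}. x i ^ d"
  let ?A = "D l ^ (2 ^ (q + l - 1) + r) * G l"
  let ?B = "D (l + 1) ^ (2 ^ (q + l - 1) + 2 * r) * G' l"
  have all: "{s \<in> R. s < l + 1} = R" "{s \<in> R. l + 1 \<le> s} = {}" using R l by auto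
  have "?B = x k ^ (2 ^ (q + l - 1) + 2 * r + (m k + j))"
    unfolding G'_def all unfolding l(3) Dk using j by (simp add: power_add)
  also have "2 ^ (q + l - 1) + 2 * r + (m k + j) = d"
  proof -
    have "q + l = q + k - 1" "l + 1 - 2 = k - 2" using l by auto
    then show ?thesis using exponent[OF l(1)] mk d by (simp add: r_def)
  qed
  finally have B: "?B = x k ^ d" .
  have "Q + ?p * ?A + ?p * (?A + x l ^ d * ?B) \<in> trunc_ideal x k d"
    using trunc_ideal_add[OF chain[OF l(1,2)] trunc_ideal_mult[OF elim[OF l(1,2)]]] .
  also have "Q + ?p * ?A + ?p * (?A + x l ^ d * ?B) = Q + (?p * ?A + ?p * ?A) + ?p * x l ^ d * ?B"
    by (simp only: distrib_left add.assoc mult.assoc)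
  also have "\<dots> = Q + (\<Prod>i=1..k. x i ^ d)"
  proof -
    have "{1..k} = insert k (insert l {1..<l})" using l by auto
    then have "(\<Prod>i=1..k. x i ^ d) = ?p * x l ^ d * x k ^ d"
      using l by (simp add: mult_ac)
    then show ?thesis unfolding B by (simp add: add_self)
  qed
  finally show ?thesis unfolding Q_def .
qed

end

section \<open>The lower bound: masses on the moment curve\<close>

definition moment :: "nat \<Rightarrow> real \<Rightarrow> nat \<Rightarrow> real" where
  "moment d s = (\<lambda>i\<in>{..<d}. s ^ (i + 1))"

definition moment_poly :: "nat \<Rightarrow> hyperplane \<Rightarrow> real poly" where
  "moment_poly d H = (\<Sum>i<d. monom (fst H i) (i + 1)) - [:snd H:]"

definition moment_mass :: "nat \<Rightarrow> real \<Rightarrow> (nat \<Rightarrow> real) measure" where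
  "moment_mass d a = distr (restrict_space lborel {a..a + 1}) (euclid d) (moment d)"

lemma poly_moment_poly: "poly (moment_poly d H) s = dotp d (fst H) (moment d s) - snd H"
  by (simp add: moment_poly_def poly_sum poly_monom dotp_def moment_def)

lemma degree_moment_poly: "degree (moment_poly d H) \<le> d"
  unfolding moment_poly_def
  by (intro degree_diff_le degree_sum_le) (auto intro: order_trans[OF degree_monom_le])

lemma moment_poly_nonzero:
  assumes "is_hyperplane d H"
  shows "moment_poly d H \<noteq> 0"
proof -
  obtain i where i: "i < d" "fst H i \<noteq> 0" using assms by (auto simp: is_hyperplane_def)
  have "coeff (moment_poly d H) (i + 1) = (\<Sum>l<d. if l = i then fst H l else 0)"
    by (simp add: moment_poly_def coeff_sum)
  then show ?thesis using i by (metis coeff_0 lessThan_iff sum.delta finite_lessThan)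
qed

lemma dotp_measurable [measurable]: "dotp d n \<in> borel_measurable (euclid d)"
  unfolding dotp_def by measurable

lemma sets_half_space [measurable]: "half_space d H g \<in> sets (euclid d)"
  unfolding half_space_def by (cases g) auto

lemma sets_hyperplane_points [measurable]: "hyperplane_points d H \<in> sets (euclid d)"
  unfolding hyperplane_points_def by measurable

lemma moment_measurable [measurable]: "moment d \<in> measurable (restrict_space lborel A) (euclid d)"
  unfolding moment_def by (intro measurable_restrict measurable_restrict_space1) measurable

lemma emeasure_moment_mass:
  assumes "B \<in> sets (euclid d)"
  shows "emeasure (moment_mass d a) B = emeasure lborel {s \<in> {a..a + 1}. moment d s \<in> B}"
proof -
  have "emeasure (moment_mass d a) B
      = emeasure (restrict_space lborel {a..a + 1}) (moment d -` B \<inter> space (restrict_space lborel {a..a + 1}))"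
    unfolding moment_mass_def using assms by (intro emeasure_distr) auto
  also have "moment d -` B \<inter> space (restrict_space lborel {a..a + 1}) = {s \<in> {a..a + 1}. moment d s \<in> B}"
    by (auto simp: space_restrict_space)
  finally show ?thesis
    by (subst (asm) emeasure_restrict_space) auto
qed

lemma moment_in_space: "moment d s \<in> space (euclid d)"
  by (simp add: moment_def space_PiM)

lemma emeasure_moment_mass_space: "emeasure (moment_mass d a) (space (moment_mass d a)) = 1"
proof -
  have "space (moment_mass d a) = space (euclid d)" by (simp add: moment_mass_def)
  moreover have "{s \<in> {a..a + 1}. moment d s \<in> space (euclid d)} = {a..a + 1}"
    using moment_in_space by blast
  ultimately show ?thesis
    using emeasure_moment_mass[OF sets.top] by simp
qed

text \<open>A hyperplane meets the curve only at the roots of a nonzero polynomial, a finite and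
  hence null set of parameters.\<close>

lemma mass_moment_mass: "mass d (moment_mass d a)"
  unfolding mass_def
proof (intro conjI allI impI)
  show "sets (moment_mass d a) = sets (euclid d)" by (simp add: moment_mass_def)
  show "finite_measure (moment_mass d a)"
    by (intro finite_measureI) (simp add: emeasure_moment_mass_space)
  fix H assume "is_hyperplane d H"
  then have "finite {s. poly (moment_poly d H) s = 0}"
    by (intro poly_roots_finite moment_poly_nonzero)
  then have "finite {s \<in> {a..a + 1}. moment d s \<in> hyperplane_points d H}"
    by (rule rev_finite_subset) (auto simp: poly_moment_poly hyperplane_points_def)
  then show "emeasure (moment_mass d a) (hyperplane_points d H) = 0"
    unfolding emeasure_moment_mass[OF sets_hyperplane_points]
    by (intro emeasure_lborel_countable countable_finite)
qed

lemma measure_moment_mass_space: "measure (moment_mass d a) (space (moment_mass d a)) = 1"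
  by (simp add: measure_def emeasure_moment_mass_space)

text \<open>Every closed cell of the partition has positive mass, so it contains a curve point away
  from the finitely many roots; there the signs are strict.\<close>

lemma equipartition_moment_mass_sign:
  assumes eq: "equipartition d I H (moment_mass d a)" and I: "finite I" "I \<noteq> {}"
    and H: "\<And>l. l \<in> I \<Longrightarrow> is_hyperplane d (H l)"
  obtains s where "s \<in> {a..a + 1}" "\<And>l. l \<in> I \<Longrightarrow> poly (moment_poly d (H l)) s \<noteq> 0"
    "\<And>l. l \<in> I \<Longrightarrow> poly (moment_poly d (H l)) s > 0 \<longleftrightarrow> g l"
proof -
  let ?B = "\<Inter>l\<in>I. half_space d (H l) (g l)"
  have B: "?B \<in> sets (euclid d)" using I by (intro sets.finite_INT) auto
  have "measure (moment_mass d a) ?B > 0"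
    using eq unfolding equipartition_def measure_moment_mass_space by simp
  then have "emeasure (moment_mass d a) ?B \<noteq> 0"
    by (auto simp: measure_def)
  then have "emeasure lborel {s \<in> {a..a + 1}. moment d s \<in> ?B} \<noteq> 0"
    using emeasure_moment_mass[OF B] by simp
  moreover define Z where "Z = (\<Union>l\<in>I. {s. poly (moment_poly d (H l)) s = 0})"
  have "finite Z"
    unfolding Z_def using I(1)
    by (intro finite_UN_I poly_roots_finite moment_poly_nonzero H)
  ultimately have "\<not> {s \<in> {a..a + 1}. moment d s \<in> ?B} \<subseteq> Z"
    by (meson countable_finite emeasure_lborel_countable finite_subset)
  then obtain s where s: "s \<in> {a..a + 1}" "moment d s \<in> ?B" "s \<notin> Z" by blast
  have 1: "poly (moment_poly d (H l)) s \<noteq> 0" if "l \<in> I" for l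
    using s(3) that by (auto simp: Z_def)
  have "poly (moment_poly d (H l)) s > 0 \<longleftrightarrow> g l" if "l \<in> I" for l
  proof -
    have "moment d s \<in> half_space d (H l) (g l)" using s(2) that by auto
    then show ?thesis
      using 1[OF that] by (cases "g l") (auto simp: half_space_def poly_moment_poly)
  qed
  then show ?thesis using s(1) 1 that by blast
qed

text \<open>Between points with different sign patterns there is a root, so counting the roots to the left
  of a point separates the sign patterns.\<close>

lemma card_sign_patterns:
  fixes p :: "'i \<Rightarrow> real poly"
  assumes I: "finite I" and p: "\<And>l. l \<in> I \<Longrightarrow> p l \<noteq> 0"
    and s: "\<And>A. A \<subseteq> I \<Longrightarrow> s A \<in> {a..b}"
      "\<And>A l. A \<subseteq> I \<Longrightarrow> l \<in> I \<Longrightarrow> poly (p l) (s A) \<noteq> 0 \<and> (poly (p l) (s A) > 0 \<longleftrightarrow> l \<in> A)"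
  shows "2 ^ card I - 1 \<le> (\<Sum>l\<in>I. card {x \<in> {a..b}. poly (p l) x = 0})"
proof -
  define Z where "Z = (\<Union>l\<in>I. {x \<in> {a..b}. poly (p l) x = 0})"
  have "finite {x \<in> {a..b}. poly (p l) x = 0}" if "l \<in> I" for l
    using poly_roots_finite[OF p[OF that]] by (rule rev_finite_subset) auto
  then have Z: "finite Z" unfolding Z_def using I by auto
  define c where "c A = card {z \<in> Z. z < s A}" for A
  have less: "c A < c B"
    if AB: "A \<subseteq> I" "B \<subseteq> I" "A \<noteq> B" "s A < s B" for A B
  proof -
    obtain l where l: "l \<in> I" "l \<in> A \<longleftrightarrow> l \<notin> B" using AB(1-3) by blast
    have "poly (p l) (s A) * poly (p l) (s B) < 0"
      using s(2)[OF AB(1) l(1)] s(2)[OF AB(2) l(1)] l(2)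
      by (cases "l \<in> A") (auto intro: mult_pos_neg mult_neg_pos)
    then obtain z where z: "s A < z" "z < s B" "poly (p l) z = 0"
      using poly_IVT[OF AB(4)] by blast
    then have "z \<in> Z" using l(1) s(1)[OF AB(1)] s(1)[OF AB(2)] by (auto simp: Z_def)
    then have "z \<in> {z \<in> Z. z < s B} - {z \<in> Z. z < s A}" using z by simp
    moreover have "{z \<in> Z. z < s A} \<subseteq> {z \<in> Z. z < s B}" using AB(4) by auto
    ultimately show ?thesis
      unfolding c_def using Z by (intro psubset_card_mono) auto
  qed
  have "inj_on c (Pow I)"
  proof (rule inj_onI)
    fix A B assume AB: "A \<in> Pow I" "B \<in> Pow I" "c A = c B"
    show "A = B"
    proof (rule ccontr)
      assume ne: "A \<noteq> B"
      then obtain l where "l \<in> I" "l \<in> A \<longleftrightarrow> l \<notin> B" using AB(1,2) by blast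
      then have "s A \<noteq> s B" using s(2)[of A l] s(2)[of B l] AB(1,2) by auto
      then consider "s A < s B" | "s B < s A" by linarith
      then show False
        using less[of A B] less[of B A] AB ne by cases auto
    qed
  qed
  moreover have "c ` Pow I \<subseteq> {..card Z}"
    unfolding c_def using Z by (auto intro: card_mono)
  ultimately have "card (Pow I) \<le> card {..card Z}"
    by (intro card_inj_on_le) auto
  then have "2 ^ card I - 1 \<le> card Z" using I by (simp add: card_Pow)
  also have "\<dots> \<le> (\<Sum>l\<in>I. card {x \<in> {a..b}. poly (p l) x = 0})"
    unfolding Z_def using I by (rule card_UN_le)
  finally show ?thesis .
qed

lemma admissible_dim_lower_bound:
  assumes "admissible_dim m \<O> k d"
  shows "(\<Sum>i=1..k. m i * (2 ^ (k - i + 1) - 1)) \<le> k * d"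
proof -
  \<comment> \<open>Numbering the masses by the pairing code and spacing them by two makes the unit
    intervals disjoint.\<close>
  define a where "a i j = 2 * real (prod_encode (i, j))" for i j
  have "\<forall>i\<in>{1..k}. \<forall>j\<in>{1..m i}. mass d (moment_mass d (a i j))"
    using mass_moment_mass by blast
  then obtain H where "\<forall>i\<in>{1..k}. is_hyperplane d (H i)"
    and "\<forall>i\<in>{1..k}. \<forall>j\<in>{1..m i}. equipartition d {i..k} H (moment_mass d (a i j))"
    using assms[unfolded admissible_dim_def, THEN spec[where x = "\<lambda>i j. moment_mass d (a i j)"]] by blast
  then have H: "\<And>i. i \<in> {1..k} \<Longrightarrow> is_hyperplane d (H i)"
    and eq: "\<And>i j. i \<in> {1..k} \<Longrightarrow> j \<in> {1..m i} \<Longrightarrow> equipartition d {i..k} H (moment_mass d (a i j))"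
    by blast+
  let ?J = "SIGMA i:{1..k}. {1..m i}"
  define p where "p l = moment_poly d (H l)" for l
  define Z where "Z l ij = {x \<in> {a (fst ij) (snd ij)..a (fst ij) (snd ij) + 1}. poly (p l) x = 0}" for l ij
  have bound: "2 ^ (k - i + 1) - 1 \<le> (\<Sum>l=1..k. card (Z l (i, j)))"
    if ij: "i \<in> {1..k}" "j \<in> {1..m i}" for i j
  proof -
    have "\<exists>s. s \<in> {a i j..a i j + 1} \<and>
        (\<forall>l\<in>{i..k}. poly (p l) s \<noteq> 0 \<and> (poly (p l) s > 0 \<longleftrightarrow> l \<in> A))" for A
    proof -
      have "{i..k} \<noteq> {}" "\<And>l. l \<in> {i..k} \<Longrightarrow> is_hyperplane d (H l)" using ij H by auto
      then show ?thesis
        using equipartition_moment_mass_sign[OF eq[OF ij], where g = "\<lambda>l. l \<in> A"]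
        unfolding p_def by (metis finite_atLeastAtMost)
    qed
    then obtain s where "\<And>A. s A \<in> {a i j..a i j + 1} \<and>
        (\<forall>l\<in>{i..k}. poly (p l) (s A) \<noteq> 0 \<and> (poly (p l) (s A) > 0 \<longleftrightarrow> l \<in> A))"
      by (metis (no_types, lifting))
    then have "2 ^ card {i..k} - 1 \<le> (\<Sum>l\<in>{i..k}. card {x \<in> {a i j..a i j + 1}. poly (p l) x = 0})"
    proof (intro card_sign_patterns[where s = s])
      fix l assume "l \<in> {i..k}"
      then have "l \<in> {1..k}" using ij by auto
      then show "p l \<noteq> 0" unfolding p_def by (intro moment_poly_nonzero H)
    qed blast+
    also have "\<dots> \<le> (\<Sum>l=1..k. card (Z l (i, j)))"
      unfolding Z_def fst_conv snd_conv using ij by (intro sum_mono2) auto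
    finally show ?thesis using ij by (simp add: Suc_diff_le)
  qed
  have roots: "(\<Sum>ij\<in>?J. card (Z l ij)) \<le> d" if l: "l \<in> {1..k}" for l
  proof -
    have nz: "p l \<noteq> 0" unfolding p_def using H[OF l] by (rule moment_poly_nonzero)
    have fin: "finite {x. poly (p l) x = 0}" using nz by (rule poly_roots_finite)
    have "Z l ij \<inter> Z l ij' = {}" if "ij \<noteq> ij'" for ij ij'
    proof -
      have "prod_encode ij \<noteq> prod_encode ij'" using that by (simp add: prod_encode_eq)
      then consider "real (prod_encode ij) + 1 \<le> real (prod_encode ij')"
        | "real (prod_encode ij') + 1 \<le> real (prod_encode ij)" by linarith
      then show ?thesis by cases (auto simp: Z_def a_def)
    qed
    moreover have "finite (Z l ij)" for ij
      unfolding Z_def using fin by (rule rev_finite_subset) auto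
    ultimately have "(\<Sum>ij\<in>?J. card (Z l ij)) = card (\<Union>ij\<in>?J. Z l ij)"
      by (intro card_UN_disjoint[symmetric]) auto
    also have "\<dots> \<le> card {x. poly (p l) x = 0}"
      by (intro card_mono fin) (auto simp: Z_def)
    also have "\<dots> \<le> degree (p l)" using nz by (rule card_poly_roots_bound)
    also have "\<dots> \<le> d" unfolding p_def by (rule degree_moment_poly)
    finally show ?thesis .
  qed
  have "(\<Sum>i=1..k. m i * (2 ^ (k - i + 1) - 1)) = (\<Sum>i=1..k. \<Sum>j=1..m i. 2 ^ (k - i + 1) - 1)"
    by simp
  also have "\<dots> \<le> (\<Sum>i=1..k. \<Sum>j=1..m i. \<Sum>l=1..k. card (Z l (i, j)))"
    using bound by (intro sum_mono) blast
  also have "\<dots> = (\<Sum>ij\<in>?J. \<Sum>l=1..k. card (Z l ij))"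
    by (subst sum.Sigma) (auto simp: case_prod_unfold)
  also have "\<dots> = (\<Sum>l=1..k. \<Sum>ij\<in>?J. card (Z l ij))"
    by (rule sum.swap)
  also have "\<dots> \<le> (\<Sum>l=1..k. d)"
    using roots by (intro sum_mono) blast
  finally show ?thesis by simp
qed

section \<open>The upper bound\<close>

lemma convergent_subseq_finite:
  fixes f :: "nat \<Rightarrow> 'x \<Rightarrow> real"
  assumes "finite S" "\<And>n x. x \<in> S \<Longrightarrow> \<bar>f n x\<bar> \<le> 1"
  shows "\<exists>r. strict_mono r \<and> (\<forall>x\<in>S. convergent (\<lambda>n. f (r n) x))"
  using assms
proof (induction S rule: finite_induct)
  case empty
  show ?case using strict_mono_id by blast
next
  case (insert y S)
  then obtain r where r: "strict_mono r" "\<forall>x\<in>S. convergent (\<lambda>n. f (r n) x)" by auto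
  have "\<forall>n. f (r n) y \<in> {-1..1}" using insert.prems[of y] by (simp add: abs_le_iff minus_le_iff)
  moreover have "seq_compact {-1..1::real}" by (intro compact_imp_seq_compact compact_Icc)
  ultimately obtain l q where q: "strict_mono q" "((\<lambda>n. f (r n) y) \<circ> q) \<longlonglongrightarrow> l"
    by (metis seq_compactE)
  have "convergent (\<lambda>n. f ((r \<circ> q) n) x)" if x: "x \<in> insert y S" for x
  proof (cases "x = y")
    case True
    then show ?thesis using q(2) by (auto simp: convergent_def o_def)
  next
    case False
    then obtain l' where "(\<lambda>n. f (r n) x) \<longlonglongrightarrow> l'" using r(2) x False unfolding convergent_def by blast
    then have "((\<lambda>n. f (r n) x) \<circ> q) \<longlonglongrightarrow> l'" using q(1) by (rule LIMSEQ_subseq_LIMSEQ)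
    then show ?thesis by (auto simp: convergent_def o_def)
  qed
  then show ?case using strict_mono_o[OF r(1) q(1)] by blast
qed

definition block_neg :: "nat \<Rightarrow> (nat \<times> nat \<Rightarrow> real) \<Rightarrow> nat \<times> nat \<Rightarrow> real" where
  "block_neg i v = (\<lambda>x. if fst x = i then - v x else v x)"

text \<open>On each grid \<open>combinatorial_zero\<close> yields a cell near which every
  \<open>F c\<close> has two values with nonpositive product. The meshes shrink to zero, and along a
  convergent subsequence continuity turns this into \<open>F c l * F c l \<le> 0\<close>.\<close>

theorem equivariant_common_zero:
  fixes F :: "'c \<Rightarrow> (nat \<times> nat \<Rightarrow> real) \<Rightarrow> real"
  assumes C: "finite C" "\<And>c. c \<in> C \<Longrightarrow> \<rho> c \<subseteq> {1..k}"
    and odd: "\<And>c i v. c \<in> C \<Longrightarrow> i \<in> {1..k} \<Longrightarrow>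
      F c (block_neg i v) = (if i \<in> \<rho> c then - F c v else F c v)"
    and cont: "\<And>c V v. c \<in> C \<Longrightarrow> (\<And>x. (\<lambda>n. V n x) \<longlonglongrightarrow> v x) \<Longrightarrow>
      (\<And>i. i \<in> {1..k} \<Longrightarrow> \<exists>a\<le>d. v (i, a) \<noteq> 0) \<Longrightarrow> (\<lambda>n. F c (V n)) \<longlonglongrightarrow> F c v"
    and prod: "(\<Prod>c\<in>C. \<Sum>i\<in>\<rho> c. X i) = (\<Prod>i=1..k. X i ^ d) + (\<Sum>i=1..k. y i * X i ^ (d + 1))"
  obtains v where "\<And>i. i \<in> {1..k} \<Longrightarrow> \<exists>a\<le>d. v (i, a) \<noteq> 0" "\<And>c. c \<in> C \<Longrightarrow> F c v = 0"
proof -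
  define M where "M n = 2 * int n + 1" for n
  define scaled where "scaled n (u :: nat \<times> nat \<Rightarrow> int) = (\<lambda>x. real_of_int (u x) / real_of_int (M n))" for n u
  define near where "near n u v \<longleftrightarrow> (\<forall>x. \<bar>u x - v x\<bar> \<le> int (card C))" for n :: nat and u v :: "nat \<times> nat \<Rightarrow> int"
  have "\<exists>v. v \<in> cube_grid.cells k d (M n) \<and> (\<forall>c\<in>C. \<exists>u w. near n u v \<and> near n w v \<and>
      F c (scaled n u) * F c (scaled n w) \<le> 0)" for n
  proof -
    interpret cube_grid k d "M n" by standard (auto simp: M_def)
    \<comment> \<open>The sign of \<open>F c\<close> is the cochain; where \<open>F c\<close>
      vanishes, the standard cochain breaks the tie with the required equivariance.\<close>
    define \<epsilon> where "\<epsilon> c u = (if F c (scaled n u) > 0 then 1 else if F c (scaled n u) < 0 then 0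
      else \<Sum>i\<in>\<rho> c. gen i u)" for c u
    have "equivariant (\<rho> c) (\<epsilon> c)" if c: "c \<in> C" for c
      unfolding equivariant_def
    proof (intro ballI)
      fix i v assume i: "i \<in> {1..k}" and v: "v \<in> cells"
      have "scaled n (neg i v) = block_neg i (scaled n v)"
        by (auto simp: scaled_def neg_def block_neg_def)
      then have "F c (scaled n (neg i v)) = (if i \<in> \<rho> c then - F c (scaled n v) else F c (scaled n v))"
        using odd[OF c i] by simp
      moreover have "(\<Sum>i\<in>\<rho> c. gen i (neg i' v)) = (\<Sum>i\<in>\<rho> c. gen i v) + of_bool (i' \<in> \<rho> c)"
        if "i' = i" for i'
        using equivariant_sum_gen[OF C(2)[OF c]] i v that by (simp add: equivariant_def)
      ultimately show "\<epsilon> c (neg i v) = \<epsilon> c v + of_bool (i \<in> \<rho> c)"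
        by (auto simp: \<epsilon>_def)
    qed
    from combinatorial_zero[OF C(1) this C(2) prod]
    obtain v where v: "v \<in> cells" "\<forall>c\<in>C. \<exists>u\<in>cells. \<exists>w\<in>cells. \<epsilon> c u \<noteq> \<epsilon> c w \<and>
      (\<forall>x. \<bar>u x - v x\<bar> \<le> int (card C) \<and> \<bar>w x - v x\<bar> \<le> int (card C))" by blast
    have "\<exists>u w. near n u v \<and> near n w v \<and> F c (scaled n u) * F c (scaled n w) \<le> 0" if "c \<in> C" for c
    proof -
      obtain u w where uw: "\<epsilon> c u \<noteq> \<epsilon> c w"
        "\<forall>x. \<bar>u x - v x\<bar> \<le> int (card C) \<and> \<bar>w x - v x\<bar> \<le> int (card C)"
        using v(2) \<open>c \<in> C\<close> by meson
      then have "F c (scaled n u) * F c (scaled n w) \<le> 0"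
        by (auto simp: \<epsilon>_def mult_le_0_iff not_less split: if_splits)
      then show ?thesis using uw(2) unfolding near_def by blast
    qed
    then show ?thesis using v(1) by blast
  qed
  then obtain v where v: "\<And>n. v n \<in> cube_grid.cells k d (M n)"
    and "\<And>n. \<forall>c\<in>C. \<exists>u w. near n u (v n) \<and> near n w (v n) \<and> F c (scaled n u) * F c (scaled n w) \<le> 0"
    by metis
  then have "\<forall>n c. \<exists>u w. c \<in> C \<longrightarrow> near n u (v n) \<and> near n w (v n) \<and> F c (scaled n u) * F c (scaled n w) \<le> 0"
    by blast
  then obtain u w where uw: "\<And>n c. c \<in> C \<Longrightarrow> near n (u n c) (v n)" "\<And>n c. c \<in> C \<Longrightarrow> near n (w n c) (v n)"
    "\<And>n c. c \<in> C \<Longrightarrow> F c (scaled n (u n c)) * F c (scaled n (w n c)) \<le> 0"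
    by metis
  define z where "z n = scaled n (v n)" for n
  have M: "M n > 0" for n by (simp add: M_def)
  have grid: "cube_grid (M n)" for n by standard (auto simp: M_def)
  have cells: "(\<forall>x. x \<notin> {1..k} \<times> {..d} \<longrightarrow> v n x = 0) \<and> (\<forall>x\<in>{1..k} \<times> {..d}. \<bar>v n x\<bar> \<le> M n) \<and>
      (\<forall>i\<in>{1..k}. \<exists>a\<le>d. \<bar>v n (i, a)\<bar> = M n)" for n
    using v[of n] unfolding cube_grid.cells_def[OF grid] cube_grid.coords_def[OF grid] mem_Collect_eq .
  have z_out: "z n x = 0" if "x \<notin> {1..k} \<times> {..d}" for n x
  proof -
    have "v n x = 0" using cells[of n] that by blast
    then show ?thesis by (simp add: z_def scaled_def)
  qed
  have z_le: "\<bar>z n x\<bar> \<le> 1" if "x \<in> {1..k} \<times> {..d}" for n x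
  proof -
    have "\<bar>v n x\<bar> \<le> M n"
      using cells[of n] that by blast
    then have "\<bar>real_of_int (v n x)\<bar> \<le> real_of_int (M n)" by linarith
    then show ?thesis using M[of n] by (simp add: z_def scaled_def abs_divide)
  qed
  have z_eq: "\<exists>a\<le>d. \<bar>z n (i, a)\<bar> = 1" if i: "i \<in> {1..k}" for n i
  proof -
    have "\<exists>a\<le>d. \<bar>v n (i, a)\<bar> = M n"
      using cells[of n] i by blast
    then obtain a where "a \<le> d" "\<bar>v n (i, a)\<bar> = M n" by blast
    then have "\<bar>real_of_int (v n (i, a))\<bar> = real_of_int (M n)" by linarith
    then have "\<bar>z n (i, a)\<bar> = 1" using M[of n] by (simp add: z_def scaled_def abs_divide)
    then show ?thesis using \<open>a \<le> d\<close> by blast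
  qed
  obtain r where r: "strict_mono r" "\<forall>x\<in>{1..k} \<times> {..d}. convergent (\<lambda>n. z (r n) x)"
    using convergent_subseq_finite[of "{1..k} \<times> {..d}" z] z_le by auto
  define l where "l x = lim (\<lambda>n. z (r n) x)" for x
  have lim_z: "(\<lambda>n. z (r n) x) \<longlonglongrightarrow> l x" for x
  proof (cases "x \<in> {1..k} \<times> {..d}")
    case True
    then show ?thesis using r(2) unfolding l_def convergent_LIMSEQ_iff by blast
  next
    case False
    then have "(\<lambda>n. z (r n) x) = (\<lambda>_. 0)" using z_out by auto
    then show ?thesis by (simp add: l_def)
  qed
  \<comment> \<open>Each block has a coordinate of absolute value 1 at every stage, so its absolute
    sum is at least 1, also in the limit.\<close>
  have nonzero: "\<exists>a\<le>d. l (i, a) \<noteq> 0" if i: "i \<in> {1..k}" for i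
  proof (rule ccontr)
    assume "\<not> ?thesis"
    then have "(\<Sum>a\<le>d. \<bar>l (i, a)\<bar>) = 0" by simp
    moreover have "(\<lambda>n. \<Sum>a\<le>d. \<bar>z (r n) (i, a)\<bar>) \<longlonglongrightarrow> (\<Sum>a\<le>d. \<bar>l (i, a)\<bar>)"
      by (intro tendsto_sum tendsto_rabs lim_z)
    moreover have "(\<Sum>a\<le>d. \<bar>z (r n) (i, a)\<bar>) \<ge> 1" for n
    proof -
      obtain a where "a \<le> d" "\<bar>z (r n) (i, a)\<bar> = 1" using z_eq[OF i] by blast
      then show ?thesis
        using member_le_sum[of a "{..d}" "\<lambda>a. \<bar>z (r n) (i, a)\<bar>"] by simp
    qed
    ultimately show False
      using LIMSEQ_le_const[of _ 0 1] by fastforce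
  qed
  have M_lim: "(\<lambda>n. real (card C) / real_of_int (M (r n))) \<longlonglongrightarrow> 0"
  proof -
    have "filterlim (\<lambda>n. real_of_int (M (r n))) at_top sequentially"
    proof (rule filterlim_at_top_mono[OF filterlim_real_sequentially])
      have "real n \<le> real_of_int (M (r n))" for n
        using seq_suble[OF r(1), of n] by (simp add: M_def)
      then show "\<forall>\<^sub>F n in sequentially. real n \<le> real_of_int (M (r n))"
        by (intro always_eventually) blast
    qed
    then show ?thesis by (rule real_tendsto_divide_at_top[OF tendsto_const])
  qed
  have lim_near: "(\<lambda>n. scaled (r n) (p (r n)) x) \<longlonglongrightarrow> l x" if p: "\<And>n. near n (p n) (v n)" for p x
  proof -
    have "(\<lambda>n. scaled (r n) (p (r n)) x - z (r n) x) \<longlonglongrightarrow> 0"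
    proof (rule Lim_null_comparison[OF always_eventually M_lim], rule allI)
      fix n
      have "\<bar>p (r n) x - v (r n) x\<bar> \<le> int (card C)" using p unfolding near_def by blast
      then have "\<bar>real_of_int (p (r n) x) - real_of_int (v (r n) x)\<bar> \<le> real (card C)" by linarith
      then show "norm (scaled (r n) (p (r n)) x - z (r n) x) \<le> real (card C) / real_of_int (M (r n))"
        using M[of "r n"]
        by (simp add: z_def scaled_def diff_divide_distrib[symmetric] abs_divide divide_right_mono)
    qed
    from tendsto_add[OF this lim_z[of x]] show ?thesis by simp
  qed
  have "F c l = 0" if c: "c \<in> C" for c
  proof -
    have "(\<lambda>n. F c (scaled (r n) (u (r n) c)) * F c (scaled (r n) (w (r n) c))) \<longlonglongrightarrow> F c l * F c l"
      using uw(1,2)[OF c] by (intro tendsto_mult cont[OF c] nonzero lim_near[where p = "\<lambda>n. u n c"] lim_near[where p = "\<lambda>n. w n c"])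
    then have "F c l * F c l \<le> 0"
      by (rule LIMSEQ_le_const2) (use uw(3)[OF c] in blast)
    then show ?thesis by (auto simp: mult_le_0_iff)
  qed
  then show ?thesis using nonzero that by blast
qed


section \<open>Sign integrals and equipartitions\<close>

definition plane :: "nat \<Rightarrow> (nat \<times> nat \<Rightarrow> real) \<Rightarrow> nat \<Rightarrow> hyperplane" where
  "plane d v l = (\<lambda>a. v (l, a), v (l, d))"

definition side :: "nat \<Rightarrow> (nat \<times> nat \<Rightarrow> real) \<Rightarrow> nat \<Rightarrow> (nat \<Rightarrow> real) \<Rightarrow> real" where
  "side d v l x = sgn (dotp d (\<lambda>a. v (l, a)) x - v (l, d))"

text \<open>As \<open>A\<close> varies, these are, up to normalisation, the Walsh-Fourier
  coefficients of the function sending a sign pattern to the mass of its cell.\<close>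

definition sign_integral ::
  "nat \<Rightarrow> (nat \<Rightarrow> real) measure \<Rightarrow> nat set \<Rightarrow> (nat \<times> nat \<Rightarrow> real) \<Rightarrow> real" where
  "sign_integral d \<mu> A v = (\<integral>x. (\<Prod>l\<in>A. side d v l x) \<partial>\<mu>)"

lemma massD:
  assumes "mass d \<mu>"
  shows "sets \<mu> = sets (euclid d)" "finite_measure \<mu>" "space \<mu> = space (euclid d)"
    "is_hyperplane d H \<Longrightarrow> hyperplane_points d H \<in> null_sets \<mu>"
proof -
  show "sets \<mu> = sets (euclid d)" "finite_measure \<mu>"
    using assms by (simp_all add: mass_def)
  then show "space \<mu> = space (euclid d)" by (intro sets_eq_imp_space_eq)
  assume "is_hyperplane d H"
  then show "hyperplane_points d H \<in> null_sets \<mu>"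
    using assms unfolding mass_def null_sets_def by (simp del: split_paired_All)
qed

lemma side_measurable: "mass d \<mu> \<Longrightarrow> side d v l \<in> borel_measurable \<mu>"
proof -
  assume "mass d \<mu>"
  then have "borel_measurable \<mu> = borel_measurable (euclid d)"
    by (intro measurable_cong_sets) (simp_all add: massD)
  moreover have "side d v l \<in> borel_measurable (euclid d)"
    unfolding side_def by measurable
  ultimately show ?thesis by metis
qed

lemma abs_side_le: "\<bar>side d v l x\<bar> \<le> 1"
  by (simp add: side_def sgn_real_def)

lemma abs_prod_side_le: "\<bar>\<Prod>l\<in>A. side d v l x\<bar> \<le> 1"
  unfolding abs_prod by (intro prod_le_1) (simp add: abs_side_le)

lemma integrable_prod_side:
  assumes "mass d \<mu>"
  shows "integrable \<mu> (\<lambda>x. \<Prod>l\<in>A. side d v l x)"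
proof -
  interpret finite_measure \<mu> using assms by (rule massD)
  show ?thesis
    using assms abs_prod_side_le
    by (intro integrable_const_bound[where B = 1] borel_measurable_prod side_measurable) auto
qed

text \<open>If the normal vector vanishes, the offset does not, and no point satisfies the equation;
  so hyperplanes at infinity are covered too.\<close>

lemma AE_off_hyperplane:
  fixes v :: "nat \<times> nat \<Rightarrow> real"
  assumes "mass d \<mu>" "\<exists>a\<le>d. v (l, a) \<noteq> 0"
  shows "AE x in \<mu>. dotp d (\<lambda>a. v (l, a)) x - v (l, d) \<noteq> 0"
proof (cases "is_hyperplane d (plane d v l)")
  case True
  show ?thesis
  proof (rule AE_I')
    show "hyperplane_points d (plane d v l) \<in> null_sets \<mu>" using massD(4)[OF assms(1) True] .
    show "{x \<in> space \<mu>. \<not> dotp d (\<lambda>a. v (l, a)) x - v (l, d) \<noteq> 0} \<subseteq> hyperplane_points d (plane d v l)"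
      using massD(3)[OF assms(1)] by (auto simp: hyperplane_points_def plane_def)
  qed
next
  case False
  then have "\<forall>a<d. v (l, a) = 0" by (simp add: is_hyperplane_def plane_def)
  then have "dotp d (\<lambda>a. v (l, a)) x = 0" "v (l, d) \<noteq> 0" for x
    using assms(2) by (auto simp: dotp_def le_less)
  then show ?thesis by simp
qed

text \<open>By dominated convergence: \<open>sgn\<close> is continuous away from zero, and almost
  every point lies off all the limiting hyperplanes.\<close>

lemma sign_integral_tendsto:
  assumes \<mu>: "mass d \<mu>" and A: "finite A" "\<And>l. l \<in> A \<Longrightarrow> \<exists>a\<le>d. v (l, a) \<noteq> 0"
    and V: "\<And>x. (\<lambda>n. V n x) \<longlonglongrightarrow> v x"
  shows "(\<lambda>n. sign_integral d \<mu> A (V n)) \<longlonglongrightarrow> sign_integral d \<mu> A v"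
  unfolding sign_integral_def
proof (rule integral_dominated_convergence[where w = "\<lambda>_. 1"])
  interpret finite_measure \<mu> using \<mu> by (rule massD)
  show "integrable \<mu> (\<lambda>_. 1 :: real)" by simp
  show "AE x in \<mu>. (\<lambda>n. \<Prod>l\<in>A. side d (V n) l x) \<longlonglongrightarrow> (\<Prod>l\<in>A. side d v l x)"
  proof -
    have "AE x in \<mu>. \<forall>l\<in>A. dotp d (\<lambda>a. v (l, a)) x - v (l, d) \<noteq> 0"
      by (intro AE_finite_allI A AE_off_hyperplane[OF \<mu>])
    then show ?thesis
      by eventually_elim (auto simp: side_def dotp_def intro!: tendsto_prod tendsto_sgn tendsto_intros V)
  qed
qed (use abs_prod_side_le in \<open>auto intro!: borel_measurable_prod side_measurable \<mu>\<close>)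

lemma side_block_neg: "side d (block_neg i v) l x = (if l = i then - 1 else 1) * side d v l x"
proof (cases "l = i")
  case True
  then have "dotp d (\<lambda>a. block_neg i v (l, a)) x - block_neg i v (l, d)
      = - (dotp d (\<lambda>a. v (l, a)) x - v (l, d))"
    by (simp add: block_neg_def dotp_def sum_negf)
  then show ?thesis using True unfolding side_def by (simp only: sgn_minus if_True) simp
qed (simp add: side_def block_neg_def)

lemma sign_integral_block_neg:
  assumes "finite A"
  shows "sign_integral d \<mu> A (block_neg i v)
    = (if i \<in> A then - sign_integral d \<mu> A v else sign_integral d \<mu> A v)"
  unfolding sign_integral_def side_block_neg prod.distrib using assms by simp

text \<open>Almost everywhere the indicator of a cell is the product of
  \<open>(\<sigma> l * side d v l x + 1) / 2\<close>. After expanding and integrating, only the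
  empty subset survives, and it contributes the total mass.\<close>

lemma equipartition_if_sign_integrals_vanish:
  assumes \<mu>: "mass d \<mu>" and I: "finite I" "I \<noteq> {}" "\<And>l. l \<in> I \<Longrightarrow> is_hyperplane d (plane d v l)"
    and zero: "\<And>A. A \<subseteq> I \<Longrightarrow> A \<noteq> {} \<Longrightarrow> sign_integral d \<mu> A v = 0"
  shows "equipartition d I (plane d v) \<mu>"
  unfolding equipartition_def
proof
  fix g :: "nat \<Rightarrow> bool"
  interpret finite_measure \<mu> using \<mu> by (rule massD)
  define \<sigma> where "\<sigma> l = (if g l then 1 else - 1 :: real)" for l
  let ?B = "\<Inter>l\<in>I. half_space d (plane d v l) (g l)"
  have B: "?B \<in> sets \<mu>"
    unfolding massD(1)[OF \<mu>] using I by (intro sets.finite_INT) auto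
  have nonzero: "\<exists>a\<le>d. v (l, a) \<noteq> 0" if "l \<in> I" for l
    using I(3)[OF that] by (auto simp: is_hyperplane_def plane_def intro: less_imp_le)
  have AE: "AE x in \<mu>. indicator ?B x = (\<Sum>A\<in>Pow I. (\<Prod>l\<in>A. \<sigma> l) * (\<Prod>l\<in>A. side d v l x)) / 2 ^ card I"
  proof -
    have "AE x in \<mu>. \<forall>l\<in>I. dotp d (\<lambda>a. v (l, a)) x - v (l, d) \<noteq> 0"
      by (intro AE_finite_allI I(1) AE_off_hyperplane[OF \<mu>] nonzero)
    then show ?thesis
      using AE_space
    proof eventually_elim
      case (elim x)
      have x: "x \<in> space (euclid d)" using elim massD(3)[OF \<mu>] by simp
      have "indicator ?B x = (\<Prod>l\<in>I. indicator (half_space d (plane d v l) (g l)) x :: real)"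
        using I(1) by (induction I rule: finite_induct) (auto simp: indicator_def)
      also have "\<dots> = (\<Prod>l\<in>I. (\<sigma> l * side d v l x + 1) / 2)"
      proof (intro prod.cong refl)
        fix l assume "l \<in> I"
        then have "dotp d (\<lambda>a. v (l, a)) x \<noteq> v (l, d)" using elim by auto
        then show "indicator (half_space d (plane d v l) (g l)) x = (\<sigma> l * side d v l x + 1) / 2"
          using x by (auto simp: \<sigma>_def side_def half_space_def plane_def sgn_real_def indicator_def)
      qed
      also have "\<dots> = (\<Prod>l\<in>I. \<sigma> l * side d v l x + 1) / 2 ^ card I"
        by (simp add: prod_dividef)
      also have "(\<Prod>l\<in>I. \<sigma> l * side d v l x + 1) = (\<Sum>A\<in>Pow I. (\<Prod>l\<in>A. \<sigma> l) * (\<Prod>l\<in>A. side d v l x))"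
        by (subst prod_add[OF I(1)]) (simp add: prod.distrib)
      finally show ?case .
    qed
  qed
  have "measure \<mu> ?B = (\<integral>x. indicator ?B x \<partial>\<mu>)"
    using B sets.sets_into_space[OF B] by (simp add: Int_absorb2)
  also have "\<dots> = (\<integral>x. (\<Sum>A\<in>Pow I. (\<Prod>l\<in>A. \<sigma> l) * (\<Prod>l\<in>A. side d v l x)) / 2 ^ card I \<partial>\<mu>)"
    using AE B by (intro integral_cong_AE)
      (auto intro!: borel_measurable_sum borel_measurable_times borel_measurable_divide
        borel_measurable_prod side_measurable \<mu>)
  also have "\<dots> = (\<Sum>A\<in>Pow I. (\<Prod>l\<in>A. \<sigma> l) * sign_integral d \<mu> A v) / 2 ^ card I"
    unfolding sign_integral_def using integrable_prod_side[OF \<mu>] by (simp add: integral_sum)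
  also have "(\<Sum>A\<in>Pow I. (\<Prod>l\<in>A. \<sigma> l) * sign_integral d \<mu> A v)
      = (\<Sum>A\<in>Pow I. if A = {} then sign_integral d \<mu> {} v else 0)"
    using zero by (intro sum.cong) auto
  also have "\<dots> = measure \<mu> (space \<mu>)"
    using I(1) by (simp add: sign_integral_def)
  finally show "measure \<mu> ?B = measure \<mu> (space \<mu>) / 2 ^ card I" .
qed

text \<open>A parameter with zero normal vector describes a hyperplane at infinity, for which the sign
  integral is, up to sign, the total mass.\<close>

lemma is_hyperplane_if_sign_integral_vanishes:
  assumes \<mu>: "mass d \<mu>" and pos: "measure \<mu> (space \<mu>) \<noteq> 0" and v: "\<exists>a\<le>d. v (l, a) \<noteq> 0"
    and zero: "sign_integral d \<mu> {l} v = 0"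
  shows "is_hyperplane d (plane d v l)"
proof (rule ccontr)
  assume "\<not> ?thesis"
  then have n: "\<forall>a<d. v (l, a) = 0" by (simp add: is_hyperplane_def plane_def)
  then have "v (l, d) \<noteq> 0" using v by (auto simp: le_less)
  moreover have "side d v l x = - sgn (v (l, d))" for x
    using n by (simp add: side_def dotp_def sgn_minus)
  ultimately show False
    using pos zero by (simp add: sign_integral_def sgn_zero_iff)
qed

section \<open>Admissibility of the claimed dimension\<close>

lemma char_two_poly: "char_two TYPE((nat \<Rightarrow> nat) \<Rightarrow>\<^sub>0 bit)"
  by standard (rule poly_mapping_eqI, simp only: lookup_add bit_add_self lookup_zero)

lemma admissible_dim_upper_bound:
  fixes q t k j :: nat and m :: "nat \<Rightarrow> nat" and \<O> :: "(nat \<times> nat) set"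
  assumes t: "1 \<le> t" "t \<le> 2 ^ q" and k: "k \<ge> 3"
    and \<O>: "\<O> \<subseteq> {(r, k) |r. 1 \<le> r \<and> r < k}"
    and j: "card \<O> = j" "1 \<le> j"
    and m1: "m 1 = 2 ^ (q + 1) - t"
    and m: "\<And>i. i \<in> {2..k - 1} \<Longrightarrow> m i = 2 ^ q * (2 ^ (i - 2) - 1) + t"
    and mk: "m k = 2 ^ q * (2 ^ (k - 2) - 1) + t - j" "j \<le> 2 ^ q * (2 ^ (k - 2) - 1) + t"
    and d: "d = 2 ^ (q + k - 1) + (2 ^ q - t)"
  shows "admissible_dim m \<O> k d"
  unfolding admissible_dim_def
proof (intro allI impI)
  fix \<mu> :: "nat \<Rightarrow> nat \<Rightarrow> (nat \<Rightarrow> real) measure"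
  assume \<mu>: "\<forall>i\<in>{1..k}. \<forall>j\<in>{1..m i}. mass d (\<mu> i j)"
  \<comment> \<open>Null masses impose no condition. Replacing them by a mass of total 1 makes
    \<open>\<nu> 1 1\<close> nonzero, which later excludes hyperplanes at infinity.\<close>
  define \<nu> where "\<nu> i j = (if measure (\<mu> i j) (space (\<mu> i j)) = 0 then moment_mass d 0 else \<mu> i j)" for i j
  have \<nu>: "mass d (\<nu> i j)" if "i \<in> {1..k}" "j \<in> {1..m i}" for i j
    using \<mu> that by (simp add: \<nu>_def mass_moment_mass)
  define R where "R = {r. (r, k) \<in> \<O>}"
  have \<O>_eq: "\<O> = (\<lambda>r. (r, k)) ` R" and R: "R \<subseteq> {1..<k}"
    using \<O> by (auto simp: R_def)
  have finR: "finite R" using R finite_subset by blast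
  have cardR: "card R = j"
    using j(1) unfolding \<O>_eq by (subst (asm) card_image) (auto intro: inj_onI)
  define J where "J = (SIGMA i:{1..k}. SIGMA j:{1..m i}. Pow {i..k} - {{}})"
  \<comment> \<open>A sign integral over \<open>A\<close> changes sign under the generators in
    \<open>A\<close>, an inner product of two normal vectors under those of both hyperplanes. So one
    mass at level \<open>i\<close> contributes \<open>dickson X {i..k}\<close>, and each
    orthogonality condition a factor \<open>X r + X k\<close>.\<close>
  define \<rho> where "\<rho> = case_sum (\<lambda>(i :: nat, j :: nat, A :: nat set). A) (\<lambda>r. {r, k})"
  define F where "F = case_sum (\<lambda>(i, j, A). sign_integral d (\<nu> i j) A)
    (\<lambda>r v. dotp d (\<lambda>a. v (r, a)) (\<lambda>a. v (k, a)))"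
  interpret char_two "TYPE((nat \<Rightarrow> nat) \<Rightarrow>\<^sub>0 bit)" by (rule char_two_poly)
  have "(\<Prod>c\<in>J <+> R. \<Sum>i\<in>\<rho> c. X i)
      = (\<Prod>c\<in>J. \<Sum>i\<in>\<rho> (Inl c). X i) * (\<Prod>r\<in>R. \<Sum>i\<in>\<rho> (Inr r). X i)"
    using finR by (subst prod.Plus) (auto simp: J_def)
  also have "(\<Prod>c\<in>J. \<Sum>i\<in>\<rho> (Inl c). X i)
      = (\<Prod>i\<in>{1..k}. \<Prod>j\<in>{1..m i}. \<Prod>A\<in>Pow {i..k} - {{}}. \<Sum>i\<in>A. X i)"
  proof -
    have "(\<Prod>c\<in>J. \<Sum>i\<in>\<rho> (Inl c). X i)
        = (\<Prod>i\<in>{1..k}. \<Prod>p\<in>(SIGMA j:{1..m i}. Pow {i..k} - {{}}). \<Sum>i\<in>snd p. X i)"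
      unfolding J_def by (subst prod.Sigma) (auto simp: \<rho>_def case_prod_unfold)
    also have "\<dots> = (\<Prod>i\<in>{1..k}. \<Prod>j\<in>{1..m i}. \<Prod>A\<in>Pow {i..k} - {{}}. \<Sum>i\<in>A. X i)"
      by (intro prod.cong refl, subst prod.Sigma) (auto simp: case_prod_unfold)
    finally show ?thesis .
  qed
  also have "\<dots> = (\<Prod>i=1..k. dickson X {i..k} ^ m i)"
    by (simp add: dickson_def)
  also have "(\<Prod>r\<in>R. \<Sum>i\<in>\<rho> (Inr r). X i) = (\<Prod>r\<in>R. X r + X k)"
    using R by (intro prod.cong) (auto simp: \<rho>_def)
  finally have "(\<Prod>c\<in>J <+> R. \<Sum>i\<in>\<rho> c. X i) + (\<Prod>i=1..k. X i ^ d) \<in> trunc_ideal X k d"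
    using prod_dickson[OF t k R cardR j(2) m1 m mk d, of X] by simp
  then obtain y where "(\<Prod>c\<in>J <+> R. \<Sum>i\<in>\<rho> c. X i) + (\<Prod>i=1..k. X i ^ d)
      = (\<Sum>i=1..k. y i * X i ^ (d + 1))"
    unfolding trunc_ideal_def by blast
  then have "(\<Prod>i=1..k. X i ^ d) + ((\<Prod>c\<in>J <+> R. \<Sum>i\<in>\<rho> c. X i) + (\<Prod>i=1..k. X i ^ d))
      = (\<Prod>i=1..k. X i ^ d) + (\<Sum>i=1..k. y i * X i ^ (d + 1))" by simp
  moreover have "a + (b + a) = b" for a b :: "(nat \<Rightarrow> nat) \<Rightarrow>\<^sub>0 bit"
    using add_self[of a] by (metis add.commute add.left_commute add_0_right)
  ultimately have prod: "(\<Prod>c\<in>J <+> R. \<Sum>i\<in>\<rho> c. X i)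
      = (\<Prod>i=1..k. X i ^ d) + (\<Sum>i=1..k. y i * X i ^ (d + 1))" by metis
  have fin: "finite (J <+> R)" using finR by (auto simp: J_def)
  have sub: "\<rho> c \<subseteq> {1..k}" if "c \<in> J <+> R" for c
    using that subsetD[OF R] k by (fastforce simp: \<rho>_def J_def)
  obtain v where v: "\<And>i. i \<in> {1..k} \<Longrightarrow> \<exists>a\<le>d. v (i, a) \<noteq> 0" "\<And>c. c \<in> J <+> R \<Longrightarrow> F c v = 0"
  proof (rule equivariant_common_zero[OF fin sub _ _ prod, of F])
    fix c i and v :: "nat \<times> nat \<Rightarrow> real"
    assume c: "c \<in> J <+> R" and i: "i \<in> {1..k}"
    show "F c (block_neg i v) = (if i \<in> \<rho> c then - F c v else F c v)"
    proof (cases c)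
      case (Inl p)
      then obtain i' j' A where "c = Inl (i', j', A)" "A \<subseteq> {i'..k}"
        using c by (cases p) (auto simp: J_def)
      then show ?thesis
        using finite_subset[of A "{i'..k}"] by (simp add: F_def \<rho>_def sign_integral_block_neg)
    next
      case (Inr r)
      then have "r \<noteq> k" using c R by auto
      then show ?thesis
        using Inr by (auto simp: F_def \<rho>_def block_neg_def dotp_def sum_negf)
    qed
  next
    fix c and V :: "nat \<Rightarrow> nat \<times> nat \<Rightarrow> real" and v
    assume c: "c \<in> J <+> R" and V: "\<And>x. (\<lambda>n. V n x) \<longlonglongrightarrow> v x"
      and nz: "\<And>i. i \<in> {1..k} \<Longrightarrow> \<exists>a\<le>d. v (i, a) \<noteq> 0"
    show "(\<lambda>n. F c (V n)) \<longlonglongrightarrow> F c v"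
    proof (cases c)
      case (Inl p)
      then obtain i' j' A where p: "c = Inl (i', j', A)" "A \<subseteq> {i'..k}" "i' \<in> {1..k}" "j' \<in> {1..m i'}"
        using c by (cases p) (auto simp: J_def)
      have "(\<lambda>n. sign_integral d (\<nu> i' j') A (V n)) \<longlonglongrightarrow> sign_integral d (\<nu> i' j') A v"
      proof (rule sign_integral_tendsto[OF \<nu>[OF p(3,4)] _ _ V])
        show "finite A" using p(2) finite_subset by blast
        show "\<exists>a\<le>d. v (l, a) \<noteq> 0" if "l \<in> A" for l
          using that p(2,3) by (intro nz) auto
      qed
      then show ?thesis by (simp add: F_def p(1))
    next
      case (Inr r)
      then show ?thesis
        by (auto simp: F_def dotp_def intro!: tendsto_intros V)
    qed
  next
    fix v
    assume "\<And>i. i \<in> {1..k} \<Longrightarrow> \<exists>a\<le>d. v (i, a) \<noteq> 0" "\<And>c. c \<in> J <+> R \<Longrightarrow> F c v = 0"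
    then show thesis by (rule that)
  qed
  have zero: "sign_integral d (\<nu> i j) A v = 0"
    if "i \<in> {1..k}" "j \<in> {1..m i}" "A \<subseteq> {i..k}" "A \<noteq> {}" for i j A
    using v(2)[of "Inl (i, j, A)"] that by (simp add: F_def J_def InlI)
  \<comment> \<open>Since \<open>m 1 \<ge> 1\<close>, the mass \<open>\<nu> 1 1\<close> is subject
    to all \<open>k\<close> hyperplanes, and each singleton sign integral vanishes on it.\<close>
  have hyp: "is_hyperplane d (plane d v l)" if l: "l \<in> {1..k}" for l
  proof (rule is_hyperplane_if_sign_integral_vanishes[where \<mu> = "\<nu> 1 1"])
    have "t < 2 ^ (q + 1)" using t by (simp add: le_less_trans[OF t(2)])
    then have 1: "1 \<in> {1..k}" "1 \<in> {1..m 1}" using m1 k by auto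
    show "mass d (\<nu> 1 1)" using \<nu>[OF 1] .
    show "measure (\<nu> 1 1) (space (\<nu> 1 1)) \<noteq> 0"
      by (simp add: \<nu>_def measure_moment_mass_space)
    show "sign_integral d (\<nu> 1 1) {l} v = 0" using l by (intro zero 1) auto
  qed (rule v(1)[OF l])
  show "\<exists>H. (\<forall>i\<in>{1..k}. is_hyperplane d (H i)) \<and> (\<forall>(r, s)\<in>\<O>. orthogonal_hyperplanes d (H r) (H s)) \<and>
      (\<forall>i\<in>{1..k}. \<forall>j\<in>{1..m i}. equipartition d {i..k} H (\<mu> i j))"
  proof (intro exI[of _ "plane d v"] conjI ballI)
    show "is_hyperplane d (plane d v i)" if "i \<in> {1..k}" for i
      using that by (rule hyp)
    fix p assume "p \<in> \<O>"
    then obtain r where r: "p = (r, k)" "r \<in> R" unfolding \<O>_eq by blast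
    then show "case p of (r, s) \<Rightarrow> orthogonal_hyperplanes d (plane d v r) (plane d v s)"
      using v(2)[of "Inr r"] by (simp add: F_def orthogonal_hyperplanes_def plane_def InrI)
  next
    fix i j assume ij: "i \<in> {1..k}" "j \<in> {1..m i}"
    show "equipartition d {i..k} (plane d v) (\<mu> i j)"
    proof (cases "measure (\<mu> i j) (space (\<mu> i j)) = 0")
      case True
      interpret finite_measure "\<mu> i j" using \<mu> ij by (intro massD(2)[of d]) auto
      have "measure (\<mu> i j) B = 0" for B
        using bounded_measure[of B] True by (metis measure_le_0_iff)
      then show ?thesis by (simp add: equipartition_def)
    next
      case False
      then have "\<nu> i j = \<mu> i j" by (simp add: \<nu>_def)
      moreover have "equipartition d {i..k} (plane d v) (\<nu> i j)"
        using ij by (intro equipartition_if_sign_integrals_vanish \<nu> hyp zero) auto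
      ultimately show ?thesis by simp
    qed
  qed
qed

section \<open>The parameter count and the value of \<open>Delta\<close>\<close>

lemma sum_weights:
  "(\<Sum>s\<le>n. (Q * (2 ^ s - 1) + T) * (2 ^ (n + 1 - s) - 1) :: int)
    = Q * ((of_nat n - 2) * 2 ^ (n + 1) + of_nat n + 4) + T * (2 ^ (n + 2) - of_nat n - 3)"
proof (induction n)
  case 0
  show ?case by simp
next
  case (Suc n)
  have geo: "(\<Sum>s\<le>n. (2::int) ^ s) = 2 ^ Suc n - 1"
    by (induction n) auto
  have "(\<Sum>s\<le>Suc n. (Q * (2 ^ s - 1) + T) * (2 ^ (Suc n + 1 - s) - 1) :: int)
      = (\<Sum>s\<le>n. (Q * (2 ^ s - 1) + T) * (2 ^ (Suc n + 1 - s) - 1)) + (Q * (2 ^ Suc n - 1) + T)"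
    by simp
  \<comment> \<open>Passing from \<open>n\<close> to \<open>Suc n\<close> doubles each weight and
    adds one, so the sum is twice the old one plus a geometric sum.\<close>
  also have "(\<Sum>s\<le>n. (Q * (2 ^ s - 1) + T) * (2 ^ (Suc n + 1 - s) - 1))
      = (\<Sum>s\<le>n. 2 * ((Q * (2 ^ s - 1) + T) * (2 ^ (n + 1 - s) - 1)) + (Q * 2 ^ s + (T - Q)))"
    by (intro sum.cong) (auto simp: Suc_diff_le algebra_simps)
  also have "\<dots> = 2 * (\<Sum>s\<le>n. (Q * (2 ^ s - 1) + T) * (2 ^ (n + 1 - s) - 1))
      + (Q * (2 ^ Suc n - 1) + (of_nat n + 1) * (T - Q))"
    by (simp add: sum.distrib sum_distrib_left[symmetric] geo)
  finally show ?case
    unfolding Suc.IH by (simp add: algebra_simps)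
qed

lemma C_count_eq:
  fixes q t k j :: nat and m :: "nat \<Rightarrow> nat"
  assumes t: "t \<le> 2 ^ q" and k: "k \<ge> 3" and j: "card \<O> = j"
    and m1: "m 1 = 2 ^ (q + 1) - t"
    and m: "\<And>i. i \<in> {2..k - 1} \<Longrightarrow> m i = 2 ^ q * (2 ^ (i - 2) - 1) + t"
    and mk: "m k = 2 ^ q * (2 ^ (k - 2) - 1) + t - j" "j \<le> 2 ^ q * (2 ^ (k - 2) - 1) + t"
  shows "C_count m \<O> k = k * (2 ^ (q + k - 1) + (2 ^ q - t))"
proof -
  define n where "n = k - 2"
  have k_eq: "k = n + 2" using k by (simp add: n_def)
  define m' where "m' i = 2 ^ q * (2 ^ (i - 2) - 1) + t" for i
  define w :: "nat \<Rightarrow> nat" where "w i = 2 ^ (k - i + 1) - 1" for i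
  have t2: "t \<le> 2 ^ (q + 1)" using t by simp
  have "{1..k} = insert 1 (insert k {2..k - 1})" and k': "1 \<notin> insert k {2..k - 1}" "k \<notin> {2..k - 1}"
    using k by auto
  then have "(\<Sum>i=1..k. m i * w i) = m 1 * w 1 + (m k * w k + (\<Sum>i=2..k - 1. m i * w i))"
    by simp
  moreover have "(\<Sum>i=2..k - 1. m i * w i) = (\<Sum>i=2..k - 1. m' i * w i)"
    using m by (intro sum.cong) (auto simp: m'_def)
  \<comment> \<open>The weight of level \<open>k\<close> is 1, so the \<open>j\<close> orthogonality
    conditions make up exactly for the \<open>j\<close> masses missing there.\<close>
  moreover have "m k * w k + j = m' k * w k"
    using mk by (simp add: m'_def w_def)
  moreover have "{2..k} = insert k {2..k - 1}" using k by auto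
  then have "(\<Sum>i=2..k. m' i * w i) = m' k * w k + (\<Sum>i=2..k - 1. m' i * w i)"
    using k'(2) by simp
  ultimately have "C_count m \<O> k = m 1 * w 1 + (\<Sum>i=2..k. m' i * w i)"
    unfolding C_count_def w_def[symmetric] j by linarith
  also have "(\<Sum>i=2..k. m' i * w i) = (\<Sum>s\<le>n. m' (s + 2) * w (s + 2))"
    unfolding k_eq by (rule sum.reindex_bij_witness[of _ "\<lambda>s. s + 2" "\<lambda>i. i - 2"]) (auto simp del: add_2_eq_Suc')
  finally have "int (C_count m \<O> k) = int (m 1) * int (w 1) + (\<Sum>s\<le>n. int (m' (s + 2)) * int (w (s + 2)))"
    by simp
  also have "(\<Sum>s\<le>n. int (m' (s + 2)) * int (w (s + 2)))
      = (\<Sum>s\<le>n. (2 ^ q * (2 ^ s - 1) + int t) * (2 ^ (n + 1 - s) - 1))"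
    by (intro sum.cong) (auto simp: m'_def w_def k_eq of_nat_diff Suc_diff_le)
  also have "int (m 1) * int (w 1) = (2 * 2 ^ q - int t) * (2 ^ (n + 2) - 1)"
    unfolding m1 using t2 by (simp add: w_def k_eq of_nat_diff)
  also have "(2 * 2 ^ q - int t) * (2 ^ (n + 2) - 1)
      + (\<Sum>s\<le>n. (2 ^ q * (2 ^ s - 1) + int t) * (2 ^ (n + 1 - s) - 1))
      = (int n + 2) * (2 ^ q * 2 ^ (n + 1) + (2 ^ q - int t))"
    unfolding sum_weights by (simp add: algebra_simps)
  also have "\<dots> = int (k * (2 ^ (q + k - 1) + (2 ^ q - t)))"
  proof -
    have 1: "2 ^ q - int t = int (2 ^ q - t)" using t by (simp add: of_nat_diff)
    have 2: "(2::int) ^ q * 2 ^ (n + 1) = int (2 ^ (q + k - 1))" by (simp add: k_eq power_add)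
    show ?thesis unfolding 1 2 by (simp only: k_eq of_nat_mult of_nat_add of_nat_numeral)
  qed
  finally show ?thesis by (simp only: of_nat_eq_iff)
qed

theorem proposition6p6:
  fixes q t k j :: nat and m :: "nat \<Rightarrow> nat" and \<O> :: "(nat \<times> nat) set"
  assumes "1 \<le> t" and "t \<le> 2 ^ q" and "k \<ge> 3"
    and "\<O> \<subseteq> {(r, k) |r. 1 \<le> r \<and> r < k}"
    and "card \<O> = j" and "1 \<le> j" and "j \<le> k - 1"
    and "m 1 = 2 ^ (q + 1) - t"
    and "\<forall>i\<in>{2..k - 1}. m i = 2 ^ q * (2 ^ (i - 2) - 1) + t"
    and "m k = 2 ^ q * (2 ^ (k - 2) - 1) + t - j"
  shows "Delta m \<O> k = enat (U_bound (m 1) k) \<and>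
         enat k * Delta m \<O> k = enat (C_count m \<O> k)"
proof -
  define d where "d = 2 ^ (q + k - 1) + (2 ^ q - t)"
  have m: "\<And>i. i \<in> {2..k - 1} \<Longrightarrow> m i = 2 ^ q * (2 ^ (i - 2) - 1) + t"
    using assms(9) by blast
  \<comment> \<open>This ensures that the natural-number subtraction in \<open>m k\<close> is not
    truncated.\<close>
  have jk: "j \<le> 2 ^ q * (2 ^ (k - 2) - 1) + t"
  proof -
    have "k - 2 < 2 ^ (k - 2)" by (rule less_exp)
    then have "j \<le> (2 ^ (k - 2) - 1) + 1" using assms(3,7) by linarith
    also have "\<dots> \<le> 2 ^ q * (2 ^ (k - 2) - 1) + t"
      using assms(1) by (intro add_mono) simp_all
    finally show ?thesis .
  qed
  have C: "C_count m \<O> k = k * d"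
    unfolding d_def using C_count_eq[OF assms(2,3,5,8) m assms(10) jk] .
  have "admissible_dim m \<O> k d"
    using admissible_dim_upper_bound[OF assms(1-6,8) m assms(10) jk d_def] .
  \<comment> \<open>The moment curve bounds only the masses, giving
    \<open>k * d \<le> k * e + j\<close>; as \<open>j < k\<close>, integrality still yields
    \<open>d \<le> e\<close>.\<close>
  moreover have "d \<le> e" if "admissible_dim m \<O> k e" for e
  proof (rule ccontr)
    assume "\<not> d \<le> e"
    then have "k * (e + 1) \<le> k * d" by (intro mult_le_mono2) simp
    moreover have "k * d \<le> k * e + j"
      using admissible_dim_lower_bound[OF that] C assms(5) by (simp add: C_count_def)
    ultimately show False using assms(3,7) by simp
  qed
  ultimately have Delta: "Delta m \<O> k = enat d"
    unfolding Delta_def by (intro antisym INF_lower INF_greatest) auto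
  \<comment> \<open>Since \<open>t \<ge> 1\<close>, the remainder \<open>2 ^ q - t\<close> is below
    \<open>2 ^ q\<close>, so \<open>floor_log\<close> reads off \<open>q\<close>.\<close>
  have m1: "m 1 = 2 ^ q + (2 ^ q - t)" using assms(2,8) by simp
  have "floor_log (m 1) = q"
    unfolding m1 using assms(1,2) by (intro floor_log_eqI) auto
  then have "U_bound (m 1) k = d"
    unfolding U_bound_def d_def by (simp only: m1 diff_add_inverse)
  then show ?thesis using Delta C by simp
qed

end
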